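(* Let $\Lambda$ be a finite alphabet and $\mathbf{T}$ a vector tree of infinite height. Then for every finite coloring of the set $\mathrm{W}(\Lambda,\mathbf{T})$ of constant words over $\Lambda$ and every subspace $X$ of $\mathrm{W}(\Lambda,\mathbf{T})$ there exists a subspace $X'$ of $\mathrm{W}(\Lambda,\mathbf{T})$ with $X'\leqslant X$ such that the set $[X']_\Lambda$ is monochromatic.
   Context: Trees. A tree is a partially ordered set $(T,\leqslant_T)$ with a minimum (root), such that for every $t\in T$ the set of strict predecessors is finite and well ordered, every non-maximal $t$ has finitely many immediate successors, and all maximal chains have the same cardinality, called the height of $T$. Infinite height means height $\omega$. $T(n)$ is the set of nodes with exactly $n$ strict predecessors; for $A\subseteq T$, $L_T(A)=\{n: T(n)\cap A\neq\emptyset\}$. A level subset of $T$ is a nonempty subset of some $T(n)$; a level subset $D_1$ dominates a level subset $D_2$ if for every $t\in D_2$ there is $s\in D_1$ with $t\leqslant_T s$. Vector trees. A vector tree $\mathbf{T}=(T_1,\dots,T_d)$ ($d\geq1$) is a finite sequence of trees of the same height. Its level product $\otimes\mathbf{T}=\bigcup_n T_1(n)\times\dots\times T_d(n)$ is ordered coordinatewise; it is a tree whose $n$-th level is $T_1(n)\times\dots\times T_d(n)$. A vector level subset of $\mathbf{T}$ is $\mathbf{D}=(D_1,\dots,D_d)$ for which there is $n$ with $\emptyset\neq D_i\subseteq T_i(n)$ for all $i$; then $L_{\mathbf{T}}(\mathbf{D})=\{n\}$ and $\otimes\mathbf{D}=D_1\times\dots\times D_d$. It dominates another vector level subset $\mathbf{D}'=(D'_1,\dots,D'_d)$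 if $D_i$ dominates $D'_i$ for all $i$. $\mathbf{T}(n)=(T_1(n),\dots,T_d(n))$. For $m\leqslant n$, $\otimes\mathbf{T}\upharpoonright[m,n)$ is the set of elements of $\otimes\mathbf{T}$ lying on levels $m,\dots,n-1$ (empty if $m=n$). Words. $\mathrm{W}(\Lambda,\mathbf{T},m,n)=\Lambda^{\otimes\mathbf{T}\upharpoonright[m,n)}$ and $\mathrm{W}(\Lambda,\mathbf{T})=\bigcup_{m\leqslant n}\mathrm{W}(\Lambda,\mathbf{T},m,n)$ (constant words; the empty function is included). Fix distinct symbols $(v_{\mathbf{s}})_{\mathbf{s}\in\otimes\mathbf{T}}$ not in $\Lambda$. For a vector level subset $\mathbf{D}$ of $\mathbf{T}$ with $L_{\mathbf{T}}(\mathbf{D})\subset[m,n)$, $\mathrm{W}_v(\Lambda,\mathbf{T},\mathbf{D},m,n)$ is the set of functions $f:\otimes\mathbf{T}\upharpoonright[m,n)\to\Lambda\cup\{v_{\mathbf{s}}:\mathbf{s}\in\otimes\mathbf{D}\}$ such that (1) for every $\mathbf{s}\in\otimes\mathbf{D}$, $f^{-1}(\{v_{\mathbf{s}}\})$ is nonempty and has $\mathbf{s}$ as its minimum in $\otimes\mathbf{T}$, and (2) $L_{\otimes\mathbf{T}}(f^{-1}(\{v_{\mathbf{s}}\}))=L_{\otimes\mathbf{T}}(f^{-1}(\{v_{\mathbf{s}'}\}))$ for all $\mathbf{s},\mathbf{s}'\in\otimes\mathbf{D}$. $\mathrm{W}_v(\Lambda,\mathbf{T})$ (variable words) is the union of these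 sets over all $m<n$ and such $\mathbf{D}$; for $f$ in it, $\mathrm{ws}(f)$ is the unique corresponding $\mathbf{D}$, and $\mathrm{bot}(f)=m$, $\mathrm{top}(f)=n$. Spans. For $f\in\mathrm{W}_v(\Lambda,\mathbf{T})$ and $\mathbf{a}=(a_{\mathbf{s}})_{\mathbf{s}\in\otimes\mathrm{ws}(f)}$ in $\Lambda$, $f(\mathbf{a})$ is the constant word obtained by replacing each occurrence of $v_{\mathbf{s}}$ by $a_{\mathbf{s}}$; $[f]_\Lambda$ is the set of all such $f(\mathbf{a})$. A sequence $(f_i)$ of variable words is compatible if $\mathrm{top}(f_i)=\mathrm{bot}(f_{i+1})$ for all consecutive indices. For such sequences, $[(f_i)_{i=0}^{q-1}]_\Lambda=\{g_0\cup\dots\cup g_{q-1}: g_i\in[f_i]_\Lambda\}$ and $[(f_i)_{i=0}^\infty]_\Lambda=\bigcup_{q\geq1}[(f_i)_{i=0}^{q-1}]_\Lambda$. Subspaces. A subspace of $\mathrm{W}(\Lambda,\mathbf{T})$ is a compatible infinite sequence $X=(f_i)_{i=0}^\infty$ in $\mathrm{W}_v(\Lambda,\mathbf{T})$ with $\mathrm{bot}(f_0)=0$ and such that $\mathrm{ws}(f_i)$ dominates $\mathbf{T}(i)$ for every $i$. $Y\leqslant X$ means $[Y]_\Lambda\subseteq[X]_\Lambda$. *)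

theory Defs
  imports Main "HOL-Library.Equipollence"
begin

text \<open>A tree is given by its reflexive order relation \<open>r\<close>; its set of nodes is \<open>Field r\<close>.\<close>

definition tree_chain_max :: "'a rel \<Rightarrow> 'a set \<Rightarrow> bool" where
  "tree_chain_max r C \<longleftrightarrow> pred_on.maxchain (Field r) (\<lambda>x y. (x, y) \<in> r) C"

definition immediate_succs :: "'a rel \<Rightarrow> 'a \<Rightarrow> 'a set" where
  "immediate_succs r t = {s \<in> aboveS r t. aboveS r t \<inter> underS r s = {}}"

text \<open>Maximal nodes have no successors at all, so the finiteness condition on immediate
  successors need not be restricted to the non-maximal nodes.\<close>

definition tree :: "'a rel \<Rightarrow> bool" where
  "tree r \<longleftrightarrow>
     Partial_order r \<and>
     (\<exists>\<rho>\<in>Field r. \<forall>t\<in>Field r. (\<rho>, t) \<in> r) \<and>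
     (\<forall>t\<in>Field r. finite (underS r t) \<and>
        well_order_on (underS r t) (Restr r (underS r t))) \<and>
     (\<forall>t\<in>Field r. finite (immediate_succs r t)) \<and>
     (\<forall>C D. tree_chain_max r C \<and> tree_chain_max r D \<longrightarrow> C \<approx> D)"

definition level :: "'a rel \<Rightarrow> nat \<Rightarrow> 'a set" where
  "level r n = {t \<in> Field r. card (underS r t) = n}"

definition dominates :: "'a rel \<Rightarrow> 'a set \<Rightarrow> 'a set \<Rightarrow> bool" where
  "dominates r D\<^sub>1 D\<^sub>2 \<longleftrightarrow> (\<forall>t\<in>D\<^sub>2. \<exists>s\<in>D\<^sub>1. (t, s) \<in> r)"

definition vector_tree :: "'a rel list \<Rightarrow> bool" where
  "vector_tree Ts \<longleftrightarrow>
     Ts \<noteq> [] \<and> (\<forall>r\<in>set Ts. tree r) \<and>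
     (\<forall>r\<in>set Ts. \<forall>r'\<in>set Ts. \<forall>C C'.
        tree_chain_max r C \<and> tree_chain_max r' C' \<longrightarrow> C \<approx> C')"

definition infinite_height :: "'a rel list \<Rightarrow> bool" where
  "infinite_height Ts \<longleftrightarrow>
     (\<forall>r\<in>set Ts. \<forall>C. tree_chain_max r C \<longrightarrow> C \<approx> (UNIV :: nat set))"

definition vlevel :: "'a rel list \<Rightarrow> nat \<Rightarrow> 'a set list" where
  "vlevel Ts n = map (\<lambda>r. level r n) Ts"

text \<open>Elements of the level product are lists; \<open>listset D\<close> is the Cartesian product of the
  entries of \<open>D\<close>. Thus \<open>listset (vlevel Ts n)\<close> is the \<open>n\<close>-th level of the level product.\<close>

definition level_product :: "'a rel list \<Rightarrow> 'a list set" where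
  "level_product Ts = (\<Union>n. listset (vlevel Ts n))"

definition level_product_order :: "'a rel list \<Rightarrow> 'a list rel" where
  "level_product_order Ts =
     {(s, t). s \<in> level_product Ts \<and> t \<in> level_product Ts \<and>
              (\<forall>i<length Ts. (s ! i, t ! i) \<in> Ts ! i)}"

definition level_product_between :: "'a rel list \<Rightarrow> nat \<Rightarrow> nat \<Rightarrow> 'a list set" where
  "level_product_between Ts m n = (\<Union>k\<in>{m..<n}. listset (vlevel Ts k))"

definition level_product_levels :: "'a rel list \<Rightarrow> 'a list set \<Rightarrow> nat set" where
  "level_product_levels Ts A = {n. listset (vlevel Ts n) \<inter> A \<noteq> {}}"

definition vector_level_subset :: "'a rel list \<Rightarrow> nat \<Rightarrow> 'a set list \<Rightarrow> bool" where
  "vector_level_subset Ts n D \<longleftrightarrow>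
     length D = length Ts \<and> (\<forall>i<length Ts. D ! i \<noteq> {} \<and> D ! i \<subseteq> level (Ts ! i) n)"

definition vdominates :: "'a rel list \<Rightarrow> 'a set list \<Rightarrow> 'a set list \<Rightarrow> bool" where
  "vdominates Ts D D' \<longleftrightarrow> (\<forall>i<length Ts. dominates (Ts ! i) (D ! i) (D' ! i))"

text \<open>Words are partial functions, so that a word determines its domain and the empty word is
  \<open>Map.empty\<close>. The constructor \<open>Var\<close> provides the symbols \<open>v\<^sub>s\<close>, pairwise distinct and distinct
  from all letters.\<close>

datatype ('l, 'a) symbol = Letter 'l | Var "'a list"

type_synonym ('l, 'a) cword = "'a list \<rightharpoonup> 'l"
type_synonym ('l, 'a) vword = "'a list \<rightharpoonup> ('l, 'a) symbol"

definition words_between :: "'l set \<Rightarrow> 'a rel list \<Rightarrow> nat \<Rightarrow> nat \<Rightarrow> ('l, 'a) cword set" where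
  "words_between \<Lambda> Ts m n = {w. dom w = level_product_between Ts m n \<and> ran w \<subseteq> \<Lambda>}"

definition const_words :: "'l set \<Rightarrow> 'a rel list \<Rightarrow> ('l, 'a) cword set" where
  "const_words \<Lambda> Ts = (\<Union>m. \<Union>n\<in>{m..}. words_between \<Lambda> Ts m n)"

definition occurrences :: "('l, 'a) vword \<Rightarrow> 'a list \<Rightarrow> 'a list set" where
  "occurrences f s = {t. f t = Some (Var s)}"

definition var_words_between ::
    "'l set \<Rightarrow> 'a rel list \<Rightarrow> 'a set list \<Rightarrow> nat \<Rightarrow> nat \<Rightarrow> ('l, 'a) vword set" where
  "var_words_between \<Lambda> Ts D m n =
     {f. (\<exists>k\<in>{m..<n}. vector_level_subset Ts k D) \<and>
         dom f = level_product_between Ts m n \<and>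
         ran f \<subseteq> Letter ` \<Lambda> \<union> Var ` listset D \<and>
         (\<forall>s\<in>listset D.
            s \<in> occurrences f s \<and> (\<forall>t\<in>occurrences f s. (s, t) \<in> level_product_order Ts)) \<and>
         (\<forall>s\<in>listset D. \<forall>s'\<in>listset D.
            level_product_levels Ts (occurrences f s) =
            level_product_levels Ts (occurrences f s'))}"

definition var_words :: "'l set \<Rightarrow> 'a rel list \<Rightarrow> ('l, 'a) vword set" where
  "var_words \<Lambda> Ts = (\<Union>D. \<Union>m. \<Union>n. var_words_between \<Lambda> Ts D m n)"

text \<open>The following descriptions are unique for variable words over a vector tree of infinite
  height; see \<open>ws_eq\<close>, \<open>bot_level_eq\<close> and \<open>top_level_eq\<close> below.\<close>

definition ws :: "'l set \<Rightarrow> 'a rel list \<Rightarrow> ('l, 'a) vword \<Rightarrow> 'a set list" where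
  "ws \<Lambda> Ts f = (THE D. \<exists>m n. f \<in> var_words_between \<Lambda> Ts D m n)"

definition bot_level :: "'l set \<Rightarrow> 'a rel list \<Rightarrow> ('l, 'a) vword \<Rightarrow> nat" where
  "bot_level \<Lambda> Ts f = (THE m. \<exists>D n. f \<in> var_words_between \<Lambda> Ts D m n)"

definition top_level :: "'l set \<Rightarrow> 'a rel list \<Rightarrow> ('l, 'a) vword \<Rightarrow> nat" where
  "top_level \<Lambda> Ts f = (THE n. \<exists>D m. f \<in> var_words_between \<Lambda> Ts D m n)"

text \<open>Only the values of \<open>a\<close> on \<open>listset (ws \<Lambda> Ts f)\<close> matter in the following substitution.\<close>

definition subst_word :: "('l, 'a) vword \<Rightarrow> ('a list \<Rightarrow> 'l) \<Rightarrow> ('l, 'a) cword" where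
  "subst_word f a = (\<lambda>t. map_option (\<lambda>x. case x of Letter l \<Rightarrow> l | Var s \<Rightarrow> a s) (f t))"

definition word_span :: "'l set \<Rightarrow> 'a rel list \<Rightarrow> ('l, 'a) vword \<Rightarrow> ('l, 'a) cword set" where
  "word_span \<Lambda> Ts f = {subst_word f a | a. \<forall>s\<in>listset (ws \<Lambda> Ts f). a s \<in> \<Lambda>}"

text \<open>Unions of partial functions are unions of their graphs.\<close>

definition finite_span ::
    "'l set \<Rightarrow> 'a rel list \<Rightarrow> (nat \<Rightarrow> ('l, 'a) vword) \<Rightarrow> nat \<Rightarrow> ('l, 'a) cword set" where
  "finite_span \<Lambda> Ts X q =
     {w. \<exists>g. (\<forall>i<q. g i \<in> word_span \<Lambda> Ts (X i)) \<and> Map.graph w = (\<Union>i<q. Map.graph (g i))}"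

definition seq_span ::
    "'l set \<Rightarrow> 'a rel list \<Rightarrow> (nat \<Rightarrow> ('l, 'a) vword) \<Rightarrow> ('l, 'a) cword set" where
  "seq_span \<Lambda> Ts X = (\<Union>q\<in>{1..}. finite_span \<Lambda> Ts X q)"

definition compatible :: "'l set \<Rightarrow> 'a rel list \<Rightarrow> (nat \<Rightarrow> ('l, 'a) vword) \<Rightarrow> bool" where
  "compatible \<Lambda> Ts X \<longleftrightarrow> (\<forall>i. top_level \<Lambda> Ts (X i) = bot_level \<Lambda> Ts (X (Suc i)))"

definition subspace :: "'l set \<Rightarrow> 'a rel list \<Rightarrow> (nat \<Rightarrow> ('l, 'a) vword) \<Rightarrow> bool" where
  "subspace \<Lambda> Ts X \<longleftrightarrow>
     (\<forall>i. X i \<in> var_words \<Lambda> Ts) \<and>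
     compatible \<Lambda> Ts X \<and>
     bot_level \<Lambda> Ts (X 0) = 0 \<and>
     (\<forall>i. vdominates Ts (ws \<Lambda> Ts (X i)) (vlevel Ts i))"

definition subspace_le ::
    "'l set \<Rightarrow> 'a rel list \<Rightarrow> (nat \<Rightarrow> ('l, 'a) vword) \<Rightarrow> (nat \<Rightarrow> ('l, 'a) vword) \<Rightarrow> bool" where
  "subspace_le \<Lambda> Ts Y X \<longleftrightarrow> seq_span \<Lambda> Ts Y \<subseteq> seq_span \<Lambda> Ts X"

definition monochromatic :: "('w \<Rightarrow> 'c) \<Rightarrow> 'w set \<Rightarrow> bool" where
  "monochromatic c A \<longleftrightarrow> (\<exists>k. \<forall>w\<in>A. c w = k)"

lemma listset_iff:
  "s \<in> listset D \<longleftrightarrow> length s = length D \<and> (\<forall>i<length D. s ! i \<in> D ! i)"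
proof (induction D arbitrary: s)
  case (Cons A D)
  show ?case
    by (cases s) (auto simp: set_Cons_def Cons.IH nth_Cons split: nat.splits)
qed auto

lemma listset_ne:
  assumes "\<And>i. i < length D \<Longrightarrow> D ! i \<noteq> {}"
  shows "listset D \<noteq> {}"
proof -
  have "map (\<lambda>A. SOME x. x \<in> A) D \<in> listset D"
    using assms by (auto simp: listset_iff some_in_eq)
  then show ?thesis by blast
qed

lemma listset_inj:
  assumes "listset D = listset E" "length D = length E"
    and ne: "\<And>i. i < length D \<Longrightarrow> D ! i \<noteq> {}" "\<And>i. i < length E \<Longrightarrow> E ! i \<noteq> {}"
  shows "D = E"
proof -
  have sub: "D ! i \<subseteq> E ! i" if eq: "listset D = listset E" "length D = length E"
    and ne: "\<And>i. i < length D \<Longrightarrow> D ! i \<noteq> {}" and i: "i < length D" for D E :: "'a set list" and i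
  proof
    fix x assume x: "x \<in> D ! i"
    obtain s where s: "s \<in> listset D" using listset_ne[OF ne] by blast
    then have "s[i := x] \<in> listset D"
      unfolding listset_iff using x i by (metis length_list_update nth_list_update)
    then show "x \<in> E ! i"
      using eq i by (auto simp: listset_iff dest!: spec[where x = i])
  qed
  show ?thesis
    using sub[of D E] sub[of E D] assms by (intro nth_equalityI) auto
qed

lemma var_words_between_inj_ws:
  assumes "f \<in> var_words_between \<Lambda> Ts D m n" "f \<in> var_words_between \<Lambda> Ts D' m' n'"
  shows "D = D'"
proof -
  have *: "listset E = {s. Var s \<in> ran f}" if "f \<in> var_words_between \<Lambda> Ts E a b" for E a b
  proof -
    have "ran f \<subseteq> Letter ` \<Lambda> \<union> Var ` listset E"
      and "\<And>s. s \<in> listset E \<Longrightarrow> f s = Some (Var s)"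
      using that by (auto simp: var_words_between_def occurrences_def)
    then show ?thesis by (auto intro: ranI)
  qed
  show ?thesis
  proof (rule listset_inj)
    show "listset D = listset D'" using *[OF assms(1)] *[OF assms(2)] by simp
  qed (use assms in \<open>auto simp: var_words_between_def vector_level_subset_def\<close>)
qed

lemma ws_eq:
  assumes "f \<in> var_words_between \<Lambda> Ts D m n"
  shows "ws \<Lambda> Ts f = D"
  unfolding ws_def using assms var_words_between_inj_ws by (intro the_equality) blast+

lemma finite_chain_has_max:
  assumes "finite F" "F \<noteq> {}" "Partial_order r" "F \<subseteq> Field r"
    and "\<And>x y. x \<in> F \<Longrightarrow> y \<in> F \<Longrightarrow> (x, y) \<in> r \<or> (y, x) \<in> r"
  shows "\<exists>t\<in>F. \<forall>x\<in>F. (x, t) \<in> r"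
  using assms(1,2,4,5)
proof (induction F rule: finite_ne_induct)
  case (singleton x)
  then show ?case by auto
next
  case (insert x F)
  then obtain t where t: "t \<in> F" "\<forall>y\<in>F. (y, t) \<in> r" by auto
  have "trans r" using assms(3) by (auto simp: order_on_defs)
  have "(x, t) \<in> r \<or> (t, x) \<in> r" "(x, x) \<in> r" using insert.prems t by auto
  then show ?case using t \<open>trans r\<close> by (metis insert_iff transD)
qed

lemma level_below_ne:
  assumes "tree r" "t \<in> Field r" "k \<le> card (underS r t)"
  shows "level r k \<noteq> {}"
  using assms(2,3)
proof (induction "card (underS r t)" arbitrary: t)
  case 0
  then show ?case by (auto simp: level_def)
next
  case (Suc n)
  show ?case
  proof (cases "k = Suc n")
    case True
    then show ?thesis using Suc by (auto simp: level_def)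
  next
    case False
    have po: "Partial_order r" and fin: "finite (underS r t)"
      and wo: "well_order_on (underS r t) (Restr r (underS r t))"
      using assms(1) Suc.prems by (auto simp: tree_def)
    have tr: "trans r" and as: "antisym r" and re: "\<And>x. x \<in> Field r \<Longrightarrow> (x, x) \<in> r"
      using po by (auto simp: order_on_defs refl_on_def)
    have sub: "underS r t \<subseteq> Field r" by (auto simp: underS_def Field_def)
    have "\<exists>u\<in>underS r t. \<forall>x\<in>underS r t. (x, u) \<in> r"
    proof (rule finite_chain_has_max[OF fin _ po sub])
      show "underS r t \<noteq> {}" using Suc.hyps(2) by force
      fix x y assume "x \<in> underS r t" "y \<in> underS r t"
      then show "(x, y) \<in> r \<or> (y, x) \<in> r"
        using wo sub re by (cases "x = y") (auto simp: order_on_defs total_on_def)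
    qed
    then obtain u where u: "u \<in> underS r t" "\<forall>x\<in>underS r t. (x, u) \<in> r" by blast
    have "underS r u = underS r t - {u}"
      using u tr as by (auto simp: underS_def dest: transD antisymD)
    then have "card (underS r u) = n" using u fin Suc.hyps(2) by simp
    then show ?thesis using Suc.hyps(1)[of u] u sub False Suc by auto
  qed
qed

lemma level_ne:
  assumes "tree r" and inf: "\<And>C. tree_chain_max r C \<Longrightarrow> C \<approx> (UNIV :: nat set)"
  shows "level r n \<noteq> {}"
proof -
  have "\<exists>C. tree_chain_max r C"
    unfolding tree_chain_max_def by (rule pred_on.Hausdorff)
  then obtain C where C: "tree_chain_max r C" ..
  have "infinite C" using eqpoll_finite_iff[OF inf[OF C]] by simp
  then obtain F where F: "F \<subseteq> C" "finite F" "card F = Suc n"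
    by (meson infinite_arbitrarily_large)
  have po: "Partial_order r" using assms(1) by (auto simp: tree_def)
  have "pred_on.chain (Field r) (\<lambda>x y. (x, y) \<in> r) C"
    using C unfolding tree_chain_max_def pred_on.maxchain_def by (rule conjunct1)
  then have CF: "C \<subseteq> Field r"
    and ch': "\<forall>x\<in>C. \<forall>y\<in>C. ((x, y) \<in> r \<or> x = y) \<or> ((y, x) \<in> r \<or> y = x)"
    unfolding pred_on.chain_def by auto
  have re: "(x, x) \<in> r" if "x \<in> Field r" for x
    using po that by (auto simp: order_on_defs refl_on_def)
  have ch: "(x, y) \<in> r \<or> (y, x) \<in> r" if "x \<in> C" "y \<in> C" for x y
    using ch' re CF that by blast
  have "\<exists>t\<in>F. \<forall>x\<in>F. (x, t) \<in> r"
  proof (rule finite_chain_has_max[OF F(2) _ po])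
    show "F \<noteq> {}" using F by force
    show "F \<subseteq> Field r" using F CF by blast
    show "\<And>x y. x \<in> F \<Longrightarrow> y \<in> F \<Longrightarrow> (x, y) \<in> r \<or> (y, x) \<in> r" using F ch by blast
  qed
  then obtain t where t: "t \<in> F" "\<forall>x\<in>F. (x, t) \<in> r" by blast
  have tF: "t \<in> Field r" using t F CF by blast
  have "card (F - {t}) \<le> card (underS r t)"
    using t assms(1) tF by (intro card_mono) (auto simp: tree_def underS_def)
  then show ?thesis using level_below_ne[OF assms(1) tF] t F by simp
qed

lemma level_product_levels_between:
  assumes "vector_tree Ts" "infinite_height Ts"
  shows "level_product_levels Ts (level_product_between Ts m n) = {m..<n}"
proof -
  have ne: "listset (vlevel Ts k) \<noteq> {}" for k
  proof (rule listset_ne)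
    fix i assume "i < length (vlevel Ts k)"
    then have i: "i < length Ts" and Ti: "Ts ! i \<in> set Ts" by (auto simp: vlevel_def)
    have "level (Ts ! i) k \<noteq> {}"
    proof (rule level_ne)
      show "tree (Ts ! i)" using assms(1) Ti by (simp add: vector_tree_def)
      show "C \<approx> (UNIV :: nat set)" if "tree_chain_max (Ts ! i) C" for C
        using assms(2) Ti that by (simp add: infinite_height_def)
    qed
    then show "vlevel Ts k ! i \<noteq> {}" using i by (simp add: vlevel_def)
  qed
  have dj: "k = l" if "s \<in> listset (vlevel Ts k)" "s \<in> listset (vlevel Ts l)" for s k l
  proof -
    have "0 < length Ts" using assms by (auto simp: vector_tree_def)
    then show ?thesis using that by (auto simp: listset_iff vlevel_def level_def)
  qed
  have "listset (vlevel Ts k) \<inter> level_product_between Ts m n \<noteq> {} \<longleftrightarrow> k \<in> {m..<n}" for k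
  proof
    assume "listset (vlevel Ts k) \<inter> level_product_between Ts m n \<noteq> {}"
    then obtain s where s: "s \<in> listset (vlevel Ts k)" "s \<in> level_product_between Ts m n"
      by auto
    then obtain l where "l \<in> {m..<n}" "s \<in> listset (vlevel Ts l)"
      unfolding level_product_between_def by (elim UN_E)
    with s(1) show "k \<in> {m..<n}" using dj by metis
  next
    assume k: "k \<in> {m..<n}"
    obtain s where "s \<in> listset (vlevel Ts k)" using ne[of k] by auto
    moreover from k this have "s \<in> level_product_between Ts m n"
      unfolding level_product_between_def by (rule UN_I)
    ultimately show "listset (vlevel Ts k) \<inter> level_product_between Ts m n \<noteq> {}" by auto
  qed
  then show ?thesis unfolding level_product_levels_def by (auto simp: set_eq_iff)
qed

lemma var_words_between_inj_levels:
  assumes "vector_tree Ts" "infinite_height Ts"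
    and f: "f \<in> var_words_between \<Lambda> Ts D m n" "f \<in> var_words_between \<Lambda> Ts D' m' n'"
  shows "m = m'" "n = n'"
proof -
  have "level_product_between Ts m n = level_product_between Ts m' n'" "m < n" "m' < n'"
    using f unfolding var_words_between_def by auto
  then have "{m..<n} = {m'..<n'}" "m < n" "m' < n'"
    using level_product_levels_between[OF assms(1,2), of m n]
      level_product_levels_between[OF assms(1,2), of m' n'] by argo+
  then show "m = m'" "n = n'" using atLeastLessThan_inj by blast+
qed

lemma bot_level_eq:
  assumes "vector_tree Ts" "infinite_height Ts" "f \<in> var_words_between \<Lambda> Ts D m n"
  shows "bot_level \<Lambda> Ts f = m"
  unfolding bot_level_def
  using assms var_words_between_inj_levels by (intro the_equality) blast+

lemma top_level_eq:
  assumes "vector_tree Ts" "infinite_height Ts" "f \<in> var_words_between \<Lambda> Ts D m n"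
  shows "top_level \<Lambda> Ts f = n"
  unfolding top_level_def
  using assms var_words_between_inj_levels by (intro the_equality) blast+

end

theory Submission
  imports Defs "HOL-Library.FuncSet"
begin

text \<open>
  The theorem follows from the infinitary Hales-Jewett theorem for words over an infinite alphabet
  that is exhausted by finite sets: words over a vector tree can encode such words in a way that
  respects spans.

  The Hales-Jewett theorem used is this (\<open>infinite_hales_jewett\<close>). Given finite sets of letters
  \<open>A 0, A 1, \<dots>\<close> and a finite colouring of the words over their union, there are words
  \<open>w 0, w 1, \<dots>\<close>, each containing a variable, such that all concatenations
  \<open>(w 0)(a 0) \<dots> (w (q - 1))(a (q - 1))\<close> with \<open>a i \<in> A i\<close> get the same colour. It is
  proved with ultrafilters on the semigroup of words: there are an idempotent ultrafilter \<open>p\<close> on the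
  constant words and an ultrafilter \<open>q\<close> on the variable words that every substitution of a letter
  maps to \<open>p\<close>. For each set in \<open>p\<close> the words \<open>w i\<close> can then be chosen one after the other such that
  all concatenations stay in the set, as in the Galvin-Glazer proof of Hindman's theorem. Filters,
  rather than closed sets of ultrafilters, serve as compact subsemigroups and left ideals.

  The reduction to words over an alphabet rests on one observation: the \<open>i\<close>-th word \<open>f\<close> of the new
  subspace has to dominate the \<open>i\<close>-th level of the trees only, however high \<open>f\<close> itself begins. Let
  \<open>D l\<close> be the vector level subset of the \<open>l\<close>-th word of the given subspace \<open>X\<close>. After passing to a
  sparse subsequence of \<open>X\<close> (\<open>dominating_subsequence\<close>), each \<open>D (l + 1)\<close> dominates \<open>D l\<close>, so every
  node of \<open>D i\<close> can be continued by an infinite branch that meets all later \<open>D l\<close>, and distinct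
  nodes give disjoint branches. A vector \<open>a\<close> of letters indexed by the product of \<open>D i\<close> can now be
  inserted at every \<open>l \<ge> i\<close>: at \<open>l\<close> it is written along the branches, and one fixed letter is
  written everywhere else. These vectors form the finite set \<open>A i\<close> of letters, and the union of the
  \<open>A i\<close> is an infinite alphabet whose words describe constant words of the span of \<open>X\<close>. A
  variable in such a word turns into the symbols \<open>v\<^sub>s\<close>, where \<open>s\<close> runs over the product of the branch
  nodes at the position at which the variable first occurs. Those nodes dominate \<open>D i\<close>, hence the
  \<open>i\<close>-th level, and the Hales-Jewett theorem gives the required subspace.
\<close>

section \<open>Ultrafilters on a semigroup\<close>

definition ultrafilter :: "'a filter \<Rightarrow> bool" where
  "ultrafilter U \<longleftrightarrow> U \<noteq> bot \<and> (\<forall>P. eventually P U \<or> eventually (\<lambda>x. \<not> P x) U)"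

lemma eventually_Inf_chain:
  fixes C :: "'a filter set"
  assumes "C \<noteq> {}" "\<And>F G. F \<in> C \<Longrightarrow> G \<in> C \<Longrightarrow> F \<le> G \<or> G \<le> F"
  shows "eventually P (Inf C) \<longleftrightarrow> (\<exists>F\<in>C. eventually P F)"
  by (rule eventually_Inf_base[OF assms(1)]) (use assms(2) in \<open>metis inf.orderE inf.orderI inf_commute order_refl\<close>)

text \<open>
  Zorn's lemma in the form that replaces compactness of the space of ultrafilters: a filter stands
  for the closed set of the ultrafilters below it, and the infimum of a chain of proper filters is
  again proper. It yields ultrafilters, minimal closed subsemigroups and minimal closed left ideals.
\<close>

lemma minimal_filter_below:
  fixes F0 :: "'a filter"
  assumes "Q F0" "F0 \<noteq> bot"
    and chain: "\<And>C. \<lbrakk>C \<noteq> {}; \<And>F. F \<in> C \<Longrightarrow> Q F; \<And>F G. F \<in> C \<Longrightarrow> G \<in> C \<Longrightarrow> F \<le> G \<or> G \<le> F\<rbrakk>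
                 \<Longrightarrow> Q (Inf C)"
  obtains F where "F \<le> F0" "Q F" "F \<noteq> bot" "\<And>G. \<lbrakk>G \<le> F; Q G; G \<noteq> bot\<rbrakk> \<Longrightarrow> G = F"
proof -
  define A where "A = {F. F \<le> F0 \<and> Q F \<and> F \<noteq> bot}"
  have "\<exists>m\<in>A. \<forall>a\<in>A. a \<le> m \<longrightarrow> a = m"
  proof (rule predicate_Zorn)
    show "partial_order_on A (relation_of (\<lambda>F G. G \<le> F) A)"
      by (auto simp: partial_order_on_def preorder_on_def relation_of_def refl_on_def trans_def antisym_def)
  next
    fix C assume "C \<in> Chains (relation_of (\<lambda>F G. G \<le> F) A)"
    then have CA: "C \<subseteq> A" and tot: "\<And>F G. F \<in> C \<Longrightarrow> G \<in> C \<Longrightarrow> F \<le> G \<or> G \<le> F"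
      by (auto simp: Chains_def relation_of_def)
    show "\<exists>u\<in>A. \<forall>a\<in>C. u \<le> a"
    proof (cases "C = {}")
      case True
      then show ?thesis using assms(1,2) by (auto simp: A_def)
    next
      case False
      have "Q (Inf C)" using chain[OF False] CA tot by (auto simp: A_def)
      moreover have "Inf C \<noteq> bot"
        using CA eventually_Inf_chain[OF False tot, of "\<lambda>_. False"]
        by (auto simp: A_def trivial_limit_def)
      moreover have "Inf C \<le> F0"
        using False CA by (auto simp: A_def intro: Inf_lower2)
      ultimately show ?thesis by (auto simp: A_def intro!: bexI[of _ "Inf C"] Inf_lower)
    qed
  qed
  then show thesis using that by (auto simp: A_def intro: order_trans)
qed

lemma minimal_filter_imp_ultrafilter:
  assumes "U \<noteq> bot" "\<And>G. \<lbrakk>G \<le> U; G \<noteq> bot\<rbrakk> \<Longrightarrow> G = U"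
  shows "ultrafilter U"
  unfolding ultrafilter_def
proof (intro conjI allI)
  fix P
  show "eventually P U \<or> eventually (\<lambda>x. \<not> P x) U"
  proof (cases "inf U (principal {x. P x}) = bot")
    case True
    then have "eventually (\<lambda>x. \<not> P x) U"
      by (simp add: trivial_limit_def eventually_inf_principal)
    then show ?thesis ..
  next
    case False
    then have "inf U (principal {x. P x}) = U" using assms(2) by simp
    moreover have "eventually P (inf U (principal {x. P x}))"
      by (simp add: eventually_inf_principal)
    ultimately show ?thesis by simp
  qed
qed (fact assms(1))

lemma ultrafilter_below:
  assumes "F \<noteq> bot"
  obtains U where "U \<le> F" "ultrafilter U"
  using minimal_filter_below[of "\<lambda>_. True" F] assms minimal_filter_imp_ultrafilter by metis

lemma ultrafilter_eventually_not:
  assumes "ultrafilter U"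
  shows "eventually (\<lambda>x. \<not> P x) U \<longleftrightarrow> \<not> eventually P U"
  using assms eventually_elim2[of P U "\<lambda>x. \<not> P x" "\<lambda>_. False"]
  by (auto simp: ultrafilter_def trivial_limit_def)

lemma ultrafilter_le_imp_eq:
  assumes "ultrafilter U" "F \<le> U" "F \<noteq> bot"
  shows "F = U"
proof (rule antisym[OF assms(2)], rule filter_leI)
  fix P assume "eventually P F"
  show "eventually P U"
  proof (rule ccontr)
    assume "\<not> eventually P U"
    then have "eventually (\<lambda>x. \<not> P x) F"
      using ultrafilter_eventually_not[OF assms(1)] filter_leD[OF assms(2)] by blast
    with \<open>eventually P F\<close> assms(3) show False
      using eventually_elim2[of P F "\<lambda>x. \<not> P x" "\<lambda>_. False"] by (auto simp: trivial_limit_def)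
  qed
qed

lemma ultrafilter_filtermap:
  "ultrafilter U \<Longrightarrow> ultrafilter (filtermap f U)"
  by (simp add: ultrafilter_def eventually_filtermap filtermap_bot_iff)

lemma ultrafilter_finite_range:
  assumes "ultrafilter U" "eventually (\<lambda>x. f x \<in> S) U" "finite S"
  obtains k where "eventually (\<lambda>x. f x = k) U"
proof (rule ccontr)
  assume "\<not> thesis"
  then have "eventually (\<lambda>x. f x \<noteq> k) U" for k
    using that ultrafilter_eventually_not[OF assms(1)] by blast
  then have "eventually (\<lambda>x. \<forall>k\<in>S. f x \<noteq> k) U"
    using assms(3) by (simp add: eventually_ball_finite)
  with assms(2) have "eventually (\<lambda>x. False) U" by eventually_elim auto
  with assms(1) show False by (simp add: ultrafilter_def trivial_limit_def)
qed

context semigroup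
begin

text \<open>
  On ultrafilters this is the usual extension of the semigroup operation to the Stone-Cech
  compactification.
\<close>

definition filter_mult :: "'a filter \<Rightarrow> 'a filter \<Rightarrow> 'a filter" (infixl "\<odot>" 70) where
  "F \<odot> G = Abs_filter (\<lambda>P. \<forall>\<^sub>F x in F. \<forall>\<^sub>F y in G. P (x \<^bold>* y))"

lemma eventually_filter_mult:
  "eventually P (F \<odot> G) \<longleftrightarrow> (\<forall>\<^sub>F x in F. \<forall>\<^sub>F y in G. P (x \<^bold>* y))"
  unfolding filter_mult_def
proof (rule eventually_Abs_filter, rule is_filter.intro)
  fix P Q
  assume "\<forall>\<^sub>F x in F. \<forall>\<^sub>F y in G. P (x \<^bold>* y)" "\<forall>\<^sub>F x in F. \<forall>\<^sub>F y in G. Q (x \<^bold>* y)"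
  then show "\<forall>\<^sub>F x in F. \<forall>\<^sub>F y in G. P (x \<^bold>* y) \<and> Q (x \<^bold>* y)"
    by eventually_elim (rule eventually_conj)
next
  fix P Q
  assume "\<forall>x. P x \<longrightarrow> Q x" and "\<forall>\<^sub>F x in F. \<forall>\<^sub>F y in G. P (x \<^bold>* y)"
  then show "\<forall>\<^sub>F x in F. \<forall>\<^sub>F y in G. Q (x \<^bold>* y)"
    by (auto elim!: eventually_mono)
qed simp

lemma filter_mult_assoc: "F \<odot> G \<odot> H = F \<odot> (G \<odot> H)"
  by (simp add: filter_eq_iff eventually_filter_mult assoc)

lemma filter_mult_mono: "F \<le> F' \<Longrightarrow> G \<le> G' \<Longrightarrow> F \<odot> G \<le> F' \<odot> G'"
  unfolding le_filter_def eventually_filter_mult by (metis (mono_tags, lifting) eventually_mono)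

lemma filter_mult_eq_bot_iff: "F \<odot> G = bot \<longleftrightarrow> F = bot \<or> G = bot"
  by (auto simp: trivial_limit_def eventually_filter_mult elim: eventually_mono)

lemma ultrafilter_filter_mult:
  assumes "ultrafilter U" "ultrafilter V"
  shows "ultrafilter (U \<odot> V)"
  using assms ultrafilter_eventually_not[OF assms(1)] ultrafilter_eventually_not[OF assms(2)]
  unfolding ultrafilter_def filter_mult_eq_bot_iff eventually_filter_mult by auto

lemma filter_mult_Inf_chain_le:
  assumes "C \<noteq> {}" "\<And>F G. F \<in> C \<Longrightarrow> G \<in> C \<Longrightarrow> F \<le> G \<or> G \<le> F"
    and "\<And>F. F \<in> C \<Longrightarrow> H \<odot> F \<le> F"
  shows "H \<odot> Inf C \<le> Inf C"
proof (rule Inf_greatest)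
  fix F assume "F \<in> C"
  then show "H \<odot> Inf C \<le> F"
    using assms(3) filter_mult_mono[OF order_refl Inf_lower] order_trans by metis
qed

text \<open>
  The Ellis-Numakura lemma for closed subsemigroups that are given by a filter \<open>F\<close> with
  \<open>F \<odot> F \<le> F\<close>. Take \<open>F\<close> minimal and an ultrafilter \<open>p \<le> F\<close>. Then \<open>F \<odot> p\<close> is again of this kind,
  so \<open>F \<odot> p = F\<close>. Hence some ultrafilter below \<open>F\<close> satisfies \<open>x \<odot> p = p\<close>; these \<open>x\<close> form a closed
  subsemigroup, which by minimality is all of \<open>F\<close> and so contains \<open>p\<close>.
\<close>

lemma idempotent_ultrafilter_below:
  assumes "F0 \<odot> F0 \<le> F0" "F0 \<noteq> bot"
  obtains p where "p \<le> F0" "ultrafilter p" "p \<odot> p = p"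
proof -
  obtain F where F: "F \<le> F0" "F \<odot> F \<le> F" "F \<noteq> bot"
    and min: "\<And>G. \<lbrakk>G \<le> F; G \<odot> G \<le> G; G \<noteq> bot\<rbrakk> \<Longrightarrow> G = F"
  proof (rule minimal_filter_below[of "\<lambda>F. F \<odot> F \<le> F" F0])
    fix C :: "'a filter set"
    assume "C \<noteq> {}" and "\<And>F. F \<in> C \<Longrightarrow> F \<odot> F \<le> F"
    then show "Inf C \<odot> Inf C \<le> Inf C"
      by (intro Inf_greatest) (metis Inf_lower filter_mult_mono order_trans)
  qed (use assms in auto)
  obtain p where p: "p \<le> F" "ultrafilter p" using ultrafilter_below[OF F(3)] .
  have pF: "p \<noteq> bot" using p by (simp add: ultrafilter_def)
  have "F \<odot> p = F"
  proof (rule min)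
    show "F \<odot> p \<le> F" using F(2) p(1) filter_mult_mono order_trans order_refl by metis
    have "p \<odot> F \<le> F" using F(2) p(1) filter_mult_mono order_trans order_refl by metis
    then have "F \<odot> (p \<odot> F) \<le> F" using F(2) filter_mult_mono order_trans order_refl by metis
    then have "F \<odot> (p \<odot> F) \<odot> p \<le> F \<odot> p" using filter_mult_mono order_refl by metis
    then show "F \<odot> p \<odot> (F \<odot> p) \<le> F \<odot> p" by (simp add: filter_mult_assoc)
  qed (use F(3) pF filter_mult_eq_bot_iff in blast)
  \<comment> \<open>The filter \<open>St\<close> describes the ultrafilters \<open>x\<close> with \<open>x \<odot> p = p\<close>.\<close>
  define St where "St = Abs_filter (\<lambda>R. \<exists>P. eventually P p \<and> (\<forall>x. (\<forall>\<^sub>F y in p. P (x \<^bold>* y)) \<longrightarrow> R x))"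
  have ev_St: "eventually R St \<longleftrightarrow> (\<exists>P. eventually P p \<and> (\<forall>x. (\<forall>\<^sub>F y in p. P (x \<^bold>* y)) \<longrightarrow> R x))" for R
    unfolding St_def
  proof (rule eventually_Abs_filter, rule is_filter.intro)
    fix R S
    assume "\<exists>P. eventually P p \<and> (\<forall>x. (\<forall>\<^sub>F y in p. P (x \<^bold>* y)) \<longrightarrow> R x)"
      and "\<exists>P. eventually P p \<and> (\<forall>x. (\<forall>\<^sub>F y in p. P (x \<^bold>* y)) \<longrightarrow> S x)"
    then obtain P Q where "eventually P p" "\<forall>x. (\<forall>\<^sub>F y in p. P (x \<^bold>* y)) \<longrightarrow> R x"
      "eventually Q p" "\<forall>x. (\<forall>\<^sub>F y in p. Q (x \<^bold>* y)) \<longrightarrow> S x" by blast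
    then show "\<exists>P. eventually P p \<and> (\<forall>x. (\<forall>\<^sub>F y in p. P (x \<^bold>* y)) \<longrightarrow> R x \<and> S x)"
      by (intro exI[of _ "\<lambda>x. P x \<and> Q x"]) (simp add: eventually_conj_iff)
  qed (use eventually_True in blast)+
  define G where "G = inf F St"
  have "G = F"
  proof (rule min)
    show "G \<le> F" by (simp add: G_def)
    show "G \<noteq> bot"
    proof
      assume "G = bot"
      then obtain R P where R: "eventually R F" and P: "eventually P p"
        and disj: "\<And>x. R x \<Longrightarrow> \<not> (\<forall>\<^sub>F y in p. P (x \<^bold>* y))"
        unfolding G_def trivial_limit_def eventually_inf ev_St by blast
      have "\<forall>\<^sub>F x in F. \<forall>\<^sub>F y in p. \<not> P (x \<^bold>* y)"
        using R by eventually_elim (use disj ultrafilter_eventually_not[OF p(2)] in blast)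
      then have "eventually (\<lambda>x. \<not> P x) (F \<odot> p)" by (simp add: eventually_filter_mult)
      then have "eventually (\<lambda>x. \<not> P x) p" using \<open>F \<odot> p = F\<close> p(1) filter_leD by metis
      then show False using P ultrafilter_eventually_not[OF p(2)] by blast
    qed
    show "G \<odot> G \<le> G"
      unfolding G_def
    proof (rule le_infI)
      show "inf F St \<odot> inf F St \<le> F"
        using F(2) filter_mult_mono[of "inf F St" F "inf F St" F] by (auto intro: order_trans)
      have "St \<odot> St \<le> St"
      proof (rule filter_leI)
        fix R assume "eventually R St"
        then obtain P where P: "eventually P p" "\<And>x. (\<forall>\<^sub>F y in p. P (x \<^bold>* y)) \<Longrightarrow> R x"
          unfolding ev_St by blast
        have "\<forall>\<^sub>F y in St. R (x \<^bold>* y)" if "\<forall>\<^sub>F y in p. P (x \<^bold>* y)" for x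
          unfolding ev_St using that P(2)[of "x \<^bold>* _"]
          by (intro exI[of _ "\<lambda>y. P (x \<^bold>* y)"]) (simp add: assoc)
        then show "eventually R (St \<odot> St)"
          unfolding eventually_filter_mult using P(1) ev_St by blast
      qed
      then show "inf F St \<odot> inf F St \<le> St"
        using filter_mult_mono[of "inf F St" St "inf F St" St] by (auto intro: order_trans)
    qed
  qed
  have "p \<le> St" using p(1) \<open>G = F\<close> by (metis G_def inf.cobounded2 order_trans)
  have "p \<odot> p \<le> p"
  proof (rule filter_leI)
    fix P assume P: "eventually P p"
    then have "\<forall>\<^sub>F x in St. \<forall>\<^sub>F y in p. P (x \<^bold>* y)" unfolding ev_St by blast
    then have "\<forall>\<^sub>F x in p. \<forall>\<^sub>F y in p. P (x \<^bold>* y)"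
      by (rule filter_leD[OF \<open>p \<le> St\<close>])
    then show "eventually P (p \<odot> p)" by (simp add: eventually_filter_mult)
  qed
  then have "p \<odot> p = p"
    using ultrafilter_le_imp_eq[OF p(2)] pF filter_mult_eq_bot_iff by blast
  then show thesis using that p F(1) by (meson order_trans)
qed

text \<open>
  An ultrafilter below \<open>principal S \<odot> p\<close> has the form \<open>s \<odot> p\<close> for an ultrafilter \<open>s\<close> containing \<open>S\<close>, and
  \<open>s \<odot> p \<odot> p = s \<odot> p\<close>. The proof avoids finding \<open>s\<close>: if \<open>P\<close> separated \<open>r\<close> from \<open>r \<odot> p\<close>, then some
  \<open>x\<close> in \<open>S\<close> would have two properties: \<open>P (x \<^bold>* z)\<close> holds for \<open>p\<close>-almost all \<open>z\<close>, and for \<open>p\<close>-almost all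
  \<open>z\<close> it fails at \<open>x \<^bold>* z \<^bold>* y\<close> for \<open>p\<close>-almost all \<open>y\<close>. This contradicts \<open>p \<odot> p = p\<close>.
\<close>

lemma right_identity_of_principal_mult:
  assumes p: "ultrafilter p" "p \<odot> p = p" and r: "ultrafilter r" "r \<le> principal S \<odot> p"
  shows "r \<odot> p = r"
proof -
  have "r \<odot> p \<le> r"
  proof (rule filter_leI, rule ccontr)
    fix P assume P: "eventually P r" and neg: "\<not> eventually P (r \<odot> p)"
    then have "\<forall>\<^sub>F x in r. P x \<and> \<not> (\<forall>\<^sub>F y in p. P (x \<^bold>* y))"
      using ultrafilter_eventually_not[OF r(1)] by (simp add: eventually_filter_mult eventually_conj_iff)
    then have "\<not> (\<forall>\<^sub>F x in r. \<not> (P x \<and> \<not> (\<forall>\<^sub>F y in p. P (x \<^bold>* y))))"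
      using ultrafilter_eventually_not[OF r(1)] by blast
    then have "\<not> (\<forall>\<^sub>F x in principal S \<odot> p. \<not> (P x \<and> \<not> (\<forall>\<^sub>F y in p. P (x \<^bold>* y))))"
      using filter_leD[OF r(2)] by blast
    then obtain x where "\<forall>\<^sub>F z in p. P (x \<^bold>* z) \<and> \<not> (\<forall>\<^sub>F y in p. P (x \<^bold>* z \<^bold>* y))"
      unfolding eventually_filter_mult eventually_principal ultrafilter_eventually_not[OF p(1)] by blast
    then have x: "\<forall>\<^sub>F z in p. P (x \<^bold>* z)" "\<forall>\<^sub>F z in p. \<not> (\<forall>\<^sub>F y in p. P (x \<^bold>* (z \<^bold>* y)))"
      by (simp_all add: eventually_conj_iff assoc)
    have "\<forall>\<^sub>F z in p \<odot> p. P (x \<^bold>* z)" using x(1) p(2) by simp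
    then have "\<forall>\<^sub>F z in p. \<forall>\<^sub>F y in p. P (x \<^bold>* (z \<^bold>* y))" by (simp add: eventually_filter_mult)
    then show False using x(2) ultrafilter_eventually_not[OF p(1)] by blast
  qed
  then show ?thesis
    using ultrafilter_le_imp_eq[OF r(1)] filter_mult_eq_bot_iff p(1) r(1)
    by (metis ultrafilter_def)
qed

lemma principal_mult_principal_le:
  assumes "\<And>x y. x \<in> S \<Longrightarrow> y \<in> T \<Longrightarrow> x \<^bold>* y \<in> U"
  shows "principal S \<odot> principal T \<le> principal U"
  using assms by (auto simp: le_filter_def eventually_filter_mult eventually_principal)

text \<open>
  The algebraic core of the Hales-Jewett theorem. Think of \<open>W\<close> as the constant words, of \<open>V\<close> as
  the variable words and of \<open>H\<close> as the substitutions. Let \<open>p\<close> be an idempotent in a minimal left ideal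
  on \<open>W\<close>, and let \<open>q\<close> be an idempotent on \<open>V\<close> with \<open>p \<odot> q = q \<odot> p = q\<close>. A substitution fixes \<open>p\<close>, so the
  image \<open>t\<close> of \<open>q\<close> is an idempotent on \<open>W\<close> with \<open>p \<odot> t = t \<odot> p = t\<close>, and minimality of \<open>p\<close> forces \<open>t = p\<close>.
\<close>

lemma idempotent_ultrafilter_common_image:
  assumes W: "W \<noteq> {}" "\<And>x y. x \<in> W \<Longrightarrow> y \<in> W \<Longrightarrow> x \<^bold>* y \<in> W"
    and V: "V \<noteq> {}" "\<And>x y. x \<in> V \<Longrightarrow> y \<in> V \<Longrightarrow> x \<^bold>* y \<in> V"
    and VW: "\<And>x y. x \<in> V \<Longrightarrow> y \<in> W \<Longrightarrow> x \<^bold>* y \<in> V" "\<And>x y. x \<in> W \<Longrightarrow> y \<in> V \<Longrightarrow> x \<^bold>* y \<in> V"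
    and hom: "\<And>h x y. h \<in> H \<Longrightarrow> h (x \<^bold>* y) = h x \<^bold>* h y"
    and fixW: "\<And>h x. h \<in> H \<Longrightarrow> x \<in> W \<Longrightarrow> h x = x"
    and img: "\<And>h x. h \<in> H \<Longrightarrow> x \<in> V \<Longrightarrow> h x \<in> W"
  obtains p q where "ultrafilter p" "p \<odot> p = p" "p \<le> principal W"
    "ultrafilter q" "q \<le> principal V" "\<And>h. h \<in> H \<Longrightarrow> filtermap h q = p"
proof -
  let ?W = "principal W" and ?V = "principal V"
  have WW: "?W \<odot> ?W \<le> ?W" using W(2) by (rule principal_mult_principal_le)
  have VV: "?V \<odot> ?V \<le> ?V" using V(2) by (rule principal_mult_principal_le)
  have WV: "?W \<odot> ?V \<le> ?V" using VW(2) by (rule principal_mult_principal_le)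
  have VW': "?V \<odot> ?W \<le> ?V" using VW(1) by (rule principal_mult_principal_le)
  have Wbot: "?W \<noteq> bot" and Vbot: "?V \<noteq> bot" using W(1) V(1) by (simp_all add: principal_eq_bot_iff)
  have mono1: "F \<odot> G \<le> F' \<odot> G" if "F \<le> F'" for F F' G using filter_mult_mono[OF that order_refl] .
  have mono2: "G \<odot> F \<le> G \<odot> F'" if "F \<le> F'" for F F' G using filter_mult_mono[OF order_refl that] .
  \<comment> \<open>The minimal closed left ideal of the ultrafilters on \<open>W\<close>.\<close>
  obtain F where F: "F \<le> ?W" "?W \<odot> F \<le> F" "F \<noteq> bot"
    and min: "\<And>G. \<lbrakk>G \<le> F; ?W \<odot> G \<le> G; G \<noteq> bot\<rbrakk> \<Longrightarrow> G = F"
    by (rule minimal_filter_below[of "\<lambda>F. ?W \<odot> F \<le> F" ?W])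
      (use WW Wbot filter_mult_Inf_chain_le in auto)
  have WF: "?W \<odot> r = F" if "r \<le> F" "ultrafilter r" for r
  proof (rule min)
    show "?W \<odot> r \<le> F" using mono2[OF that(1)] F(2) by (rule order_trans)
    show "?W \<odot> (?W \<odot> r) \<le> ?W \<odot> r"
      using mono1[OF WW, of r] by (simp add: filter_mult_assoc)
    show "?W \<odot> r \<noteq> bot" using that(2) Wbot by (simp add: filter_mult_eq_bot_iff ultrafilter_def)
  qed
  have "F \<odot> F \<le> F" using mono1[OF F(1)] F(2) by (rule order_trans)
  then obtain p where p: "p \<le> F" "ultrafilter p" "p \<odot> p = p"
    using F(3) by (rule idempotent_ultrafilter_below)
  have pW: "p \<le> ?W" using p(1) F(1) by (rule order_trans)
  \<comment> \<open>An idempotent \<open>r\<close> below \<open>?V \<odot> p\<close> satisfies \<open>r \<odot> p = r\<close>, and then \<open>p \<odot> r\<close> is the wanted \<open>q\<close>.\<close>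
  define J where "J = ?V \<odot> p"
  have "p \<odot> ?V \<le> ?V" using mono1[OF pW] WV by (rule order_trans)
  then have "?V \<odot> (p \<odot> ?V) \<le> ?V" using VV by (meson mono2 order_trans)
  then have "?V \<odot> (p \<odot> ?V) \<odot> p \<le> ?V \<odot> p" by (rule mono1)
  then have "J \<odot> J \<le> J" by (simp add: J_def filter_mult_assoc)
  moreover have "J \<noteq> bot" using p(2) Vbot by (simp add: J_def filter_mult_eq_bot_iff ultrafilter_def)
  ultimately obtain r where r: "r \<le> J" "ultrafilter r" "r \<odot> r = r"
    by (rule idempotent_ultrafilter_below)
  have rp: "r \<odot> p = r"
    using right_identity_of_principal_mult[OF p(2,3) r(2)] r(1) by (simp add: J_def)
  define q where "q = p \<odot> r"
  have q: "ultrafilter q" using p(2) r(2) by (simp add: q_def ultrafilter_filter_mult)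
  have qq: "q \<odot> q = q" "p \<odot> q = q" "q \<odot> p = q"
    unfolding q_def by (metis filter_mult_assoc rp r(3) p(3))+
  have "r \<le> ?V" using r(1) mono2[OF pW, of ?V] VW' unfolding J_def by (meson order_trans)
  then have qV: "q \<le> ?V" unfolding q_def using filter_mult_mono[OF pW] WV by (meson order_trans)
  have "filtermap h q = p" if h: "h \<in> H" for h
  proof -
    define t where "t = filtermap h q"
    have fm: "filtermap h (A \<odot> B) = filtermap h A \<odot> filtermap h B" for A B
      by (simp add: filter_eq_iff eventually_filtermap eventually_filter_mult hom[OF h])
    have "eventually (\<lambda>x. x \<in> W) p" using pW by (simp add: le_principal)
    then have "eventually (\<lambda>x. h x = x) p" by eventually_elim (rule fixW[OF h])
    then have hp: "filtermap h p = p"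
      by (auto simp: filter_eq_iff eventually_filtermap intro!: eventually_subst elim: eventually_mono)
    have t: "ultrafilter t" "t \<odot> t = t" "p \<odot> t = t" "t \<odot> p = t"
      unfolding t_def using q qq fm hp by (simp_all add: ultrafilter_filtermap flip: fm) (metis fm hp qq)+
    have "t \<le> ?W" using qV img[OF h]
      by (auto simp: t_def le_principal eventually_filtermap elim: eventually_mono)
    then have "t \<odot> p \<le> ?W \<odot> p" by (rule mono1)
    then have "t \<le> F" using t(4) WF[OF p(1,2)] by simp
    then have "p \<le> ?W \<odot> t" using WF[OF _ t(1)] p(1) by simp
    then have "p \<odot> t = p" using right_identity_of_principal_mult[OF t(1,2) p(2)] by blast
    then show ?thesis using t(3) by (simp add: t_def)
  qed
  then show thesis using that p pW q qV by blast
qed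

end

section \<open>An infinitary Hales-Jewett theorem\<close>

text \<open>
  Words with a variable are lists over \<open>'b option\<close>, with \<open>None\<close> as the variable.
\<close>

definition plug :: "'b \<Rightarrow> 'b option list \<Rightarrow> 'b list" where
  "plug a w = map (\<lambda>x. case x of None \<Rightarrow> a | Some b \<Rightarrow> b) w"

text \<open>
  Let \<open>p\<close> and \<open>q\<close> be as in \<open>idempotent_ultrafilter_common_image\<close>. One colour class belongs to \<open>p\<close>, and
  \<open>star\<close> is the part of it from which one can continue \<open>p\<close>-almost surely. Since every substitution maps
  \<open>q\<close> to \<open>p\<close>, \<open>q\<close>-almost every variable word stays in \<open>star\<close> for all letters of a finite set \<open>A n\<close> and
  behind each of the finitely many concatenations formed before, so the words \<open>w n\<close> can be chosen
  one after the other. The union of the sets \<open>A n\<close> may be infinite, since only the letters of \<open>A n\<close>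
  have to be controlled when \<open>w n\<close> is chosen.
\<close>

theorem infinite_hales_jewett:
  fixes A :: "nat \<Rightarrow> 'b set" and c :: "'b list \<Rightarrow> 'c"
  assumes fin: "\<And>i. finite (A i)" and col: "finite (c ` lists (\<Union>i. A i))"
  obtains w k where "\<And>i. None \<in> set (w i)" "\<And>i. set (w i) \<subseteq> insert None (Some ` (\<Union>i. A i))"
    "\<And>q a. \<lbrakk>q \<ge> 1; \<And>i. i < q \<Longrightarrow> a i \<in> A i\<rbrakk>
       \<Longrightarrow> c (concat (map (\<lambda>i. plug (a i) (w i)) [0..<q])) = k"
proof -
  define \<Sigma> where "\<Sigma> = (\<Union>i. A i)"
  define h where "h = (\<lambda>a w. map Some (plug (a :: 'b) w))"
  define W where "W = lists (Some ` \<Sigma>)"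
  define V where "V = {w \<in> lists (insert None (Some ` \<Sigma>)). None \<in> set w}"
  obtain p q where p: "ultrafilter p" "append.filter_mult p p = p" "p \<le> principal W"
    and q: "ultrafilter q" "q \<le> principal V" and hq: "\<And>g. g \<in> h ` \<Sigma> \<Longrightarrow> filtermap g q = p"
  proof (rule append.idempotent_ultrafilter_common_image[of W V "h ` \<Sigma>"])
    have "[None] \<in> V" by (simp add: V_def)
    then show "V \<noteq> {}" by blast
    show "W \<noteq> {}" by (auto simp: W_def)
    show "g x = x" if "g \<in> h ` \<Sigma>" "x \<in> W" for g x
      using that by (auto simp: W_def h_def plug_def intro!: map_idI)
    show "g x \<in> W" if "g \<in> h ` \<Sigma>" "x \<in> V" for g x
      using that by (fastforce simp: W_def V_def h_def plug_def in_lists_conv_set split: option.split)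
  qed (auto simp: W_def V_def h_def plug_def)
  define C where "C = (\<lambda>x. c (map the x))"
  have "C x \<in> c ` lists \<Sigma>" if "x \<in> W" for x
    using that by (fastforce simp: W_def C_def)
  then have "eventually (\<lambda>x. C x \<in> c ` lists \<Sigma>) p"
    using p(3) by (auto simp: le_principal elim: eventually_mono)
  then obtain k where k: "eventually (\<lambda>x. C x = k) p"
    using ultrafilter_finite_range p(1) col unfolding \<Sigma>_def by metis
  define star where "star = (\<lambda>x. C x = k \<and> (\<forall>\<^sub>F y in p. C (x @ y) = k))"
  have pp: "\<forall>\<^sub>F x in p. \<forall>\<^sub>F y in p. P (x @ y)" if "eventually P p" for P
    using that p(2) append.eventually_filter_mult[of P p p] by simp
  have star_p: "eventually star p"
    unfolding star_def using k pp[OF k] by eventually_elim simp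
  have star_shift: "\<forall>\<^sub>F y in p. star (x @ y)" if "star x" for x
  proof -
    have "\<forall>\<^sub>F y in p. C (x @ y) = k" using that by (simp add: star_def)
    from this pp[OF this] show ?thesis unfolding star_def by eventually_elim simp
  qed
  define good where "good = (\<lambda>Z. finite Z \<and> (\<forall>z\<in>Z. \<forall>\<^sub>F y in p. star (z @ y)))"
  have step: "\<exists>w\<in>V. \<forall>z\<in>Z. \<forall>a\<in>A n. star (z @ h a w)" if "good Z" for Z n
  proof -
    have "\<forall>\<^sub>F y in p. \<forall>z\<in>Z. star (z @ y)"
      using that by (auto simp: good_def intro: eventually_ball_finite)
    then have "\<forall>\<^sub>F w in q. \<forall>z\<in>Z. star (z @ h a w)" if "a \<in> A n" for a
    proof -
      have "filtermap (h a) q = p" using that by (intro hq) (auto simp: \<Sigma>_def)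
      with \<open>\<forall>\<^sub>F y in p. \<forall>z\<in>Z. star (z @ y)\<close>
      have "\<forall>\<^sub>F y in filtermap (h a) q. \<forall>z\<in>Z. star (z @ y)" by simp
      then show ?thesis by (simp add: eventually_filtermap)
    qed
    then have "\<forall>\<^sub>F w in q. \<forall>a\<in>A n. \<forall>z\<in>Z. star (z @ h a w)"
      using fin by (auto intro: eventually_ball_finite)
    moreover have "\<forall>\<^sub>F w in q. w \<in> V" using q(2) by (simp add: le_principal)
    ultimately have "\<forall>\<^sub>F w in q. w \<in> V \<and> (\<forall>z\<in>Z. \<forall>a\<in>A n. star (z @ h a w))"
      by eventually_elim blast
    moreover have "q \<noteq> bot" using q(1) by (simp add: ultrafilter_def)
    ultimately show ?thesis using eventually_happens' by blast
  qed
  \<comment> \<open>\<open>Z n\<close> collects the concatenations of the first \<open>n\<close> words. The empty word in \<open>Z 0\<close> need not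
    lie in \<open>star\<close>, but it can be continued like the elements of \<open>star\<close>.\<close>
  have "\<exists>Z. \<forall>n. (good (Z n) \<and> (if n = 0 then Z n = {[]} else \<forall>z\<in>Z n. star z)) \<and>
      (\<exists>w\<in>V. Z (Suc n) = {z @ h a w | z a. z \<in> Z n \<and> a \<in> A n})"
  proof (rule dependent_nat_choice)
    show "\<exists>Z. good Z \<and> (if 0 = (0::nat) then Z = {[]} else \<forall>z\<in>Z. star z)"
      using star_p by (auto simp: good_def)
  next
    fix Z and n :: nat assume "good Z \<and> (if n = 0 then Z = {[]} else \<forall>z\<in>Z. star z)"
    then have Z: "good Z" by simp
    obtain w where w: "w \<in> V" "\<forall>z\<in>Z. \<forall>a\<in>A n. star (z @ h a w)" using step[OF Z] by blast
    define Z' where "Z' = {z @ h a w | z a. z \<in> Z \<and> a \<in> A n}"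
    have "Z' = (\<lambda>(z, a). z @ h a w) ` (Z \<times> A n)" by (auto simp: Z'_def)
    then have "finite Z'" using Z fin by (simp add: good_def)
    moreover have "\<forall>z\<in>Z'. star z" using w(2) by (auto simp: Z'_def)
    ultimately show "\<exists>Z'. (good Z' \<and> (if Suc n = 0 then Z' = {[]} else \<forall>z\<in>Z'. star z)) \<and>
        (\<exists>w\<in>V. Z' = {z @ h a w | z a. z \<in> Z \<and> a \<in> A n})"
      using w(1) star_shift by (intro exI[of _ Z']) (auto simp: good_def Z'_def)
  qed
  then obtain Z where Z: "\<And>n. good (Z n) \<and> (if n = 0 then Z n = {[]} else \<forall>z\<in>Z n. star z)"
    and ex_w: "\<And>n. \<exists>w\<in>V. Z (Suc n) = {z @ h a w | z a. z \<in> Z n \<and> a \<in> A n}" by blast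
  have Z0: "Z 0 = {[]}" using Z[of 0] by simp
  have Zstar: "star z" if "n > 0" "z \<in> Z n" for n z using Z[of n] that by simp
  have "\<exists>w. \<forall>n. w n \<in> V \<and> Z (Suc n) = {z @ h a (w n) | z a. z \<in> Z n \<and> a \<in> A n}"
    using ex_w by (intro choice) blast
  then obtain w where w: "\<And>n. w n \<in> V"
    and ZS: "\<And>n. Z (Suc n) = {z @ h a (w n) | z a. z \<in> Z n \<and> a \<in> A n}" by blast
  have mem: "map Some (concat (map (\<lambda>i. plug (a i) (w i)) [0..<n])) \<in> Z n"
    if "\<And>i. i < n \<Longrightarrow> a i \<in> A i" for n a
    using that
  proof (induction n)
    case (Suc n)
    then show ?case by (auto simp: ZS h_def)
  qed (simp add: Z0)
  show thesis
  proof (rule that)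
    show "None \<in> set (w i)" "set (w i) \<subseteq> insert None (Some ` (\<Union>i. A i))" for i
      using w[of i] by (auto simp: V_def \<Sigma>_def)
    fix n a assume "1 \<le> (n::nat)" "\<And>i. i < n \<Longrightarrow> a i \<in> A i"
    then have "star (map Some (concat (map (\<lambda>i. plug (a i) (w i)) [0..<n])))"
      using mem Zstar by (metis One_nat_def Suc_le_lessD)
    then show "c (concat (map (\<lambda>i. plug (a i) (w i)) [0..<n])) = k"
      by (simp add: star_def C_def comp_def)
  qed
qed

lemma length_plug [simp]: "length (plug a w) = length w"
  by (simp add: plug_def)

lemma length_concat_upt: "length (concat (map f [0..<q])) = (\<Sum>j<q. length (f j))"
  by (induction q) simp_all

lemma nth_concat_upt:
  "i < q \<Longrightarrow> p < length (f i) \<Longrightarrow>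
   concat (map f [0..<q]) ! ((\<Sum>j<i. length (f j)) + p) = f i ! p"
proof (induction q)
  case (Suc q)
  have len: "length (concat (map f [0..<q])) = (\<Sum>j<q. length (f j))" by (rule length_concat_upt)
  show ?case
  proof (cases "i = q")
    case True
    then show ?thesis using len Suc.prems by (simp add: nth_append)
  next
    case False
    then have "i < q" using Suc.prems by simp
    have "(\<Sum>j<Suc i. length (f j)) \<le> (\<Sum>j<q. length (f j))"
      using \<open>i < q\<close> by (intro sum_mono2) auto
    then have "(\<Sum>j<i. length (f j)) + p < (\<Sum>j<q. length (f j))" using Suc.prems(2) by simp
    then show ?thesis using Suc.IH[OF \<open>i < q\<close> Suc.prems(2)] len by (simp add: nth_append)
  qed
qed simp

section \<open>Nodes of infinite trees\<close>

definition infinite_tree :: "'a rel \<Rightarrow> bool" where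
  "infinite_tree r \<longleftrightarrow> tree r \<and> (\<forall>C. tree_chain_max r C \<longrightarrow> infinite C)"

context
  fixes r :: "'a rel"
  assumes r: "tree r"
begin

lemma tree_trans: "(x, y) \<in> r \<Longrightarrow> (y, z) \<in> r \<Longrightarrow> (x, z) \<in> r"
  and tree_antisym: "(x, y) \<in> r \<Longrightarrow> (y, x) \<in> r \<Longrightarrow> x = y"
  and tree_refl: "x \<in> Field r \<Longrightarrow> (x, x) \<in> r"
  using r by (auto simp: tree_def order_on_defs refl_on_def dest: transD antisymD)

lemma tree_finite_underS: "finite (underS r t)"
proof (cases "t \<in> Field r")
  case True
  then show ?thesis using r by (simp add: tree_def)
next
  case False
  then have "underS r t = {}" by (auto simp: underS_def Field_def)
  then show ?thesis by simp
qed

lemma tree_below_comparable: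
  assumes "(x, z) \<in> r" "(y, z) \<in> r"
  shows "(x, y) \<in> r \<or> (y, x) \<in> r"
proof (cases "x = z \<or> y = z \<or> x = y")
  case True
  then show ?thesis using assms tree_refl by (auto simp: Field_def)
next
  case False
  have "z \<in> Field r" using assms by (auto simp: Field_def)
  then have "total_on (underS r z) (Restr r (underS r z))"
    using r by (auto simp: tree_def order_on_defs)
  then show ?thesis using False assms by (auto simp: total_on_def underS_def)
qed

lemma tree_level_strict_mono:
  assumes "(x, y) \<in> r" "x \<noteq> y"
  shows "card (underS r x) < card (underS r y)"
proof (rule psubset_card_mono[OF tree_finite_underS])
  have "x \<in> underS r y" "x \<notin> underS r x" using assms by (auto simp: underS_def)
  moreover have "underS r x \<subseteq> underS r y"
    using assms tree_trans tree_antisym unfolding underS_def by blast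
  ultimately show "underS r x \<subset> underS r y" by blast
qed

lemma tree_level_unique_below:
  assumes "x \<in> level r n" "y \<in> level r n" "(x, z) \<in> r" "(y, z) \<in> r"
  shows "x = y"
  using tree_below_comparable[OF assms(3,4)] tree_level_strict_mono[of x y]
    tree_level_strict_mono[of y x] assms(1,2) by (auto simp: level_def)

lemma tree_predecessor:
  assumes "t \<in> level r (Suc n)"
  obtains u where "u \<in> level r n" "(u, t) \<in> r" "u \<noteq> t" "\<And>x. (x, t) \<in> r \<Longrightarrow> x \<noteq> t \<Longrightarrow> (x, u) \<in> r"
proof -
  have sub: "underS r t \<subseteq> Field r" by (auto simp: underS_def Field_def)
  have "\<exists>u\<in>underS r t. \<forall>x\<in>underS r t. (x, u) \<in> r"
  proof (rule finite_chain_has_max[OF tree_finite_underS _ _ sub])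
    show "underS r t \<noteq> {}" using assms by (auto simp: level_def)
    show "Partial_order r" using r by (simp add: tree_def)
    show "(x, y) \<in> r \<or> (y, x) \<in> r" if "x \<in> underS r t" "y \<in> underS r t" for x y
      using that tree_below_comparable by (auto simp: underS_def)
  qed
  then obtain u where u: "u \<in> underS r t" "\<forall>x\<in>underS r t. (x, u) \<in> r" by blast
  then have "underS r u = underS r t - {u}"
    using tree_trans tree_antisym unfolding underS_def by blast
  then have "card (underS r u) = n"
    using u(1) assms tree_finite_underS[of t] by (simp add: level_def)
  then have "u \<in> level r n" using u sub by (auto simp: level_def)
  then show thesis using that u by (auto simp: underS_def)
qed

lemma finite_level: "finite (level r n)"
proof (induction n)
  case 0
  obtain \<rho> where \<rho>: "\<forall>t\<in>Field r. (\<rho>, t) \<in> r" using r by (auto simp: tree_def)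
  have "level r 0 \<subseteq> {\<rho>}"
  proof
    fix x assume "x \<in> level r 0"
    then have "x \<in> Field r" "underS r x = {}" using tree_finite_underS by (auto simp: level_def)
    then show "x \<in> {\<rho>}" using \<rho> by (auto simp: underS_def)
  qed
  then show ?case by (rule finite_subset) simp
next
  case (Suc n)
  have "level r (Suc n) \<subseteq> (\<Union>u\<in>level r n. immediate_succs r u)"
  proof
    fix t assume t: "t \<in> level r (Suc n)"
    obtain u where u: "u \<in> level r n" "(u, t) \<in> r" "u \<noteq> t"
      "\<And>x. (x, t) \<in> r \<Longrightarrow> x \<noteq> t \<Longrightarrow> (x, u) \<in> r"
      using tree_predecessor[OF t] by metis
    have "aboveS r u \<inter> underS r t = {}"
      using u(4) tree_antisym unfolding aboveS_def underS_def by blast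
    then have "t \<in> immediate_succs r u"
      using u(2,3) by (auto simp: immediate_succs_def aboveS_def)
    then show "t \<in> (\<Union>u\<in>level r n. immediate_succs r u)" using u(1) by blast
  qed
  moreover have "finite (immediate_succs r u)" if "u \<in> level r n" for u
    using r that by (auto simp: tree_def level_def)
  ultimately show ?case using Suc by (meson finite_UN_I finite_subset)
qed

end

text \<open>
  Otherwise the finitely many nodes below \<open>t\<close>, together with \<open>t\<close>, would be a maximal chain.
\<close>

lemma infinite_tree_no_maximal:
  assumes "infinite_tree r" "t \<in> Field r"
  shows "\<exists>s. (t, s) \<in> r \<and> s \<noteq> t"
proof (rule ccontr)
  assume "\<not> ?thesis"
  then have top: "\<And>s. (t, s) \<in> r \<Longrightarrow> s = t" by blast
  have r: "tree r" using assms(1) by (simp add: infinite_tree_def)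
  note [simp] = tree_refl[OF r]
  let ?C = "{x. (x, t) \<in> r}"
  have ch: "pred_on.chain (Field r) (\<lambda>x y. (x, y) \<in> r) ?C"
    using tree_below_comparable[OF r] by (auto simp: pred_on.chain_def Field_def)
  have "S = ?C" if chS: "pred_on.chain (Field r) (\<lambda>x y. (x, y) \<in> r) S" and "?C \<subseteq> S" for S
  proof -
    have "t \<in> S" using that(2) assms(2) by auto
    have "(x, t) \<in> r" if "x \<in> S" for x
    proof -
      have "(x, t) \<in> r \<or> (t, x) \<in> r \<or> x = t"
        using chS \<open>t \<in> S\<close> that unfolding pred_on.chain_def by blast
      then show ?thesis using top[of x] tree_refl[OF r assms(2)] by auto
    qed
    then show ?thesis using that(2) by blast
  qed
  then have "tree_chain_max r ?C"
    using ch unfolding tree_chain_max_def pred_on.maxchain_def by blast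
  moreover have "?C = insert t (underS r t)" using assms(2) by (auto simp: underS_def)
  ultimately show False
    using assms(1) tree_finite_underS[OF r, of t] by (auto simp: infinite_tree_def)
qed

text \<open>
  Since no node is maximal, there are nodes of arbitrarily high level above \<open>t\<close>; descending from
  one of them through its predecessors reaches level \<open>j\<close> without leaving the nodes above \<open>t\<close>.
\<close>

lemma infinite_tree_extend:
  assumes inf: "infinite_tree r" and t: "t \<in> level r i" and "i \<le> j"
  obtains s where "s \<in> level r j" "(t, s) \<in> r"
proof -
  have r: "tree r" using inf by (simp add: infinite_tree_def)
  have tF: "t \<in> Field r" and ti: "card (underS r t) = i" using t by (auto simp: level_def)
  have "\<exists>s. (t, s) \<in> r \<and> m \<le> card (underS r s)" for m
  proof (induction m)
    case 0
    then show ?case using tree_refl[OF r tF] by auto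
  next
    case (Suc m)
    then obtain s where s: "(t, s) \<in> r" "m \<le> card (underS r s)" by blast
    have "s \<in> Field r" using s by (auto simp: Field_def)
    then obtain s' where "(s, s') \<in> r" "s' \<noteq> s" using infinite_tree_no_maximal[OF inf] by blast
    then show ?case
      using s tree_trans[OF r s(1)] tree_level_strict_mono[OF r, of s s'] by (intro exI[of _ s']) auto
  qed
  then obtain s where s: "(t, s) \<in> r" "j \<le> card (underS r s)" by blast
  from s have "\<exists>u. u \<in> level r j \<and> (t, u) \<in> r"
  proof (induction "card (underS r s)" arbitrary: s rule: less_induct)
    case less
    have sF: "s \<in> Field r" using less.prems by (auto simp: Field_def)
    show ?case
    proof (cases "card (underS r s) = j")
      case True
      then show ?thesis using less.prems sF by (auto simp: level_def)
    next
      case False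
      then obtain n where n: "card (underS r s) = Suc n" "j \<le> n"
        using less.prems(2) by (cases "card (underS r s)") auto
      then have "s \<in> level r (Suc n)" using sF by (simp add: level_def)
      then obtain u where u: "u \<in> level r n" "\<And>x. (x, s) \<in> r \<Longrightarrow> x \<noteq> s \<Longrightarrow> (x, u) \<in> r"
        using tree_predecessor[OF r] by metis
      have "t \<noteq> s" using n ti \<open>i \<le> j\<close> by auto
      then have "(t, u) \<in> r" using u(2) less.prems(1) by blast
      moreover have "card (underS r u) = n" using u(1) by (simp add: level_def)
      ultimately show ?thesis using less.hyps[of u] n by simp
    qed
  qed
  then show thesis using that by blast
qed

section \<open>Vector trees\<close>

locale infinite_vector_tree =
  fixes Ts :: "'a rel list"
  assumes vt: "vector_tree Ts" and ih: "infinite_height Ts"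
begin

lemma nonempty: "Ts \<noteq> []"
  using vt by (simp add: vector_tree_def)

lemma infinite_tree_nth: "i < length Ts \<Longrightarrow> infinite_tree (Ts ! i)"
  using vt ih eqpoll_finite_iff infinite_UNIV_nat
  unfolding infinite_tree_def vector_tree_def infinite_height_def by (meson nth_mem)

lemma tree_nth: "i < length Ts \<Longrightarrow> tree (Ts ! i)"
  using infinite_tree_nth by (simp add: infinite_tree_def)

lemma vlevel_unique:
  assumes "s \<in> listset (vlevel Ts k)" "s \<in> listset (vlevel Ts l)"
  shows "k = l"
proof -
  have "0 < length Ts" using nonempty by simp
  then show ?thesis using assms by (auto simp: listset_iff vlevel_def level_def)
qed

lemma mem_level_product_between_iff:
  assumes "s \<in> listset (vlevel Ts k)"
  shows "s \<in> level_product_between Ts m n \<longleftrightarrow> m \<le> k \<and> k < n"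
proof
  assume "s \<in> level_product_between Ts m n"
  then obtain l where "l \<in> {m..<n}" "s \<in> listset (vlevel Ts l)"
    unfolding level_product_between_def by blast
  moreover from this(2) have "k = l" by (rule vlevel_unique[OF assms])
  ultimately show "m \<le> k \<and> k < n" by simp
next
  assume "m \<le> k \<and> k < n"
  then have "k \<in> {m..<n}" by simp
  then show "s \<in> level_product_between Ts m n"
    unfolding level_product_between_def using assms by (rule UN_I)
qed

lemma product_order_refl:
  assumes "s \<in> level_product Ts"
  shows "(s, s) \<in> level_product_order Ts"
proof -
  have "(s ! i, s ! i) \<in> Ts ! i" if "i < length Ts" for i
    by (rule tree_refl[OF tree_nth[OF that]])
      (use assms that in \<open>auto simp: level_product_def listset_iff vlevel_def level_def\<close>)
  then show ?thesis using assms by (simp add: level_product_order_def)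
qed

lemma product_order_trans:
  assumes "(s, t) \<in> level_product_order Ts" "(t, u) \<in> level_product_order Ts"
  shows "(s, u) \<in> level_product_order Ts"
proof -
  have "(s ! i, u ! i) \<in> Ts ! i" if "i < length Ts" for i
    using tree_trans[OF tree_nth[OF that], of "s ! i" "t ! i" "u ! i"] assms that
    by (simp add: level_product_order_def)
  then show ?thesis using assms by (simp add: level_product_order_def)
qed

lemma dominates_trans:
  assumes "i < length Ts" "dominates (Ts ! i) A B" "dominates (Ts ! i) B C"
  shows "dominates (Ts ! i) A C"
  unfolding dominates_def
proof
  fix t assume "t \<in> C"
  then obtain s where s: "s \<in> B" "(t, s) \<in> Ts ! i" using assms(3) by (auto simp: dominates_def)
  then obtain u where "u \<in> A" "(s, u) \<in> Ts ! i" using assms(2) by (auto simp: dominates_def)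
  then show "\<exists>u\<in>A. (t, u) \<in> Ts ! i"
    using tree_trans[OF tree_nth[OF assms(1)] s(2)] by blast
qed

lemma vdominates_trans:
  "vdominates Ts A B \<Longrightarrow> vdominates Ts B C \<Longrightarrow> vdominates Ts A C"
  using dominates_trans unfolding vdominates_def by blast

lemma vdominates_vlevel:
  assumes "i \<le> j"
  shows "vdominates Ts (vlevel Ts j) (vlevel Ts i)"
  unfolding vdominates_def dominates_def
proof (intro allI impI ballI)
  fix k t assume k: "k < length Ts" and "t \<in> vlevel Ts i ! k"
  then have "t \<in> level (Ts ! k) i" by (simp add: vlevel_def)
  then obtain s where "s \<in> level (Ts ! k) j" "(t, s) \<in> Ts ! k"
    using infinite_tree_extend[OF infinite_tree_nth[OF k] _ assms] by blast
  then show "\<exists>s\<in>vlevel Ts j ! k. (t, s) \<in> Ts ! k" using k by (auto simp: vlevel_def)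
qed

lemma vdominates_mono:
  "vdominates Ts A B \<Longrightarrow> (\<And>i. i < length Ts \<Longrightarrow> C ! i \<subseteq> B ! i) \<Longrightarrow> vdominates Ts A C"
  unfolding vdominates_def dominates_def by blast

lemma vector_level_subset_sub:
  assumes "vector_level_subset Ts k D"
  shows "listset D \<subseteq> listset (vlevel Ts k)"
  using assms by (fastforce simp: vector_level_subset_def listset_iff vlevel_def)

lemma listset_nonempty:
  "vector_level_subset Ts k D \<Longrightarrow> listset D \<noteq> {}"
  by (intro listset_ne) (simp add: vector_level_subset_def)

lemma finite_listset:
  assumes "vector_level_subset Ts k D"
  shows "finite (listset D)"
proof -
  have "finite A" if "A \<in> set D" for A
    using assms that finite_subset[OF _ finite_level[OF tree_nth]]
    by (metis in_set_conv_nth vector_level_subset_def)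
  then have "finite (\<Union>(set D))" by simp
  moreover have "listset D \<subseteq> {s. set s \<subseteq> \<Union>(set D) \<and> length s = length D}"
    by (fastforce simp: listset_iff in_set_conv_nth)
  ultimately show ?thesis by (metis finite_lists_length_eq finite_subset)
qed

end

section \<open>Substitution into sequences of variable words\<close>

lemma var_words_betweenD:
  assumes "f \<in> var_words_between \<Lambda> Ts D m n"
  shows "\<exists>k\<in>{m..<n}. vector_level_subset Ts k D"
    and "dom f = level_product_between Ts m n"
    and "ran f \<subseteq> Letter ` \<Lambda> \<union> Var ` listset D"
    and "\<And>s. s \<in> listset D \<Longrightarrow> f s = Some (Var s)"
    and "\<And>s t. s \<in> listset D \<Longrightarrow> f t = Some (Var s) \<Longrightarrow> (s, t) \<in> level_product_order Ts"
    and "\<And>s s'. s \<in> listset D \<Longrightarrow> s' \<in> listset D \<Longrightarrow>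
      level_product_levels Ts (occurrences f s) = level_product_levels Ts (occurrences f s')"
proof -
  note f = assms[unfolded var_words_between_def mem_Collect_eq]
  show "\<exists>k\<in>{m..<n}. vector_level_subset Ts k D" by (rule conjunct1[OF f])
  note f = conjunct2[OF f]
  show "dom f = level_product_between Ts m n" by (rule conjunct1[OF f])
  note f = conjunct2[OF f]
  show "ran f \<subseteq> Letter ` \<Lambda> \<union> Var ` listset D" by (rule conjunct1[OF f])
  note f = conjunct2[OF f]
  show "f s = Some (Var s)" if "s \<in> listset D" for s
    using bspec[OF conjunct1[OF f] that] by (simp add: occurrences_def)
  show "(s, t) \<in> level_product_order Ts" if "s \<in> listset D" "f t = Some (Var s)" for s t
    using bspec[OF conjunct1[OF f] that(1)] that(2) by (simp add: occurrences_def)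
  note f = conjunct2[OF f]
  show "level_product_levels Ts (occurrences f s) = level_product_levels Ts (occurrences f s')"
    if "s \<in> listset D" "s' \<in> listset D" for s s'
    using bspec[OF bspec[OF f that(1)] that(2)] .
qed

text \<open>
  For a sequence of words with disjoint domains, the words \<open>X m, \<dots>, X (n - 1)\<close> are united after
  the symbol \<open>v\<^sub>s\<close> of \<open>X l\<close> has been replaced by \<open>\<tau> l s\<close>. The least \<open>l\<close> with \<open>t \<in> dom (X l)\<close> is the only
  one. The constant words of the span arise in the same way from \<open>fill\<close>, where letters are
  substituted and \<open>m\<close> is \<open>0\<close>.
\<close>

definition glue ::
    "(nat \<Rightarrow> ('l, 'a) vword) \<Rightarrow> (nat \<Rightarrow> 'a list \<Rightarrow> ('l, 'a) symbol) \<Rightarrow> nat \<Rightarrow> nat \<Rightarrow> ('l, 'a) vword"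
  where "glue X \<tau> m n = (\<lambda>t. let l = (LEAST l. t \<in> dom (X l)) in
     if m \<le> l \<and> l < n then map_option (case_symbol Letter (\<tau> l)) (X l t) else None)"

definition fill ::
    "(nat \<Rightarrow> ('l, 'a) vword) \<Rightarrow> (nat \<Rightarrow> 'a list \<Rightarrow> 'l) \<Rightarrow> nat \<Rightarrow> ('l, 'a) cword"
  where "fill X h n = (\<lambda>t. let l = (LEAST l. t \<in> dom (X l)) in
     if l < n then subst_word (X l) (h l) t else None)"

lemma option_eqI: "(\<And>x. a = Some x \<longleftrightarrow> b = Some x) \<Longrightarrow> a = b"
  by (metis not_Some_eq)

text \<open>
  Compatible sequences of variable words that start at level \<open>0\<close>, given together with their vector
  level subsets \<open>D i\<close> and bottom levels \<open>N i\<close>.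
\<close>

locale word_sequence = infinite_vector_tree Ts for Ts :: "'a rel list" +
  fixes \<Lambda> :: "'l set" and X :: "nat \<Rightarrow> ('l, 'a) vword"
    and D :: "nat \<Rightarrow> 'a set list" and N :: "nat \<Rightarrow> nat"
  assumes N0: "N 0 = 0"
    and words: "\<And>i. X i \<in> var_words_between \<Lambda> Ts (D i) (N i) (N (Suc i))"
begin

lemma D_level:
  obtains k where "N i \<le> k" "k < N (Suc i)" "vector_level_subset Ts k (D i)"
  using var_words_betweenD(1)[OF words[of i]] by auto

lemma N_strict_mono: "strict_mono N"
proof (unfold strict_mono_Suc_iff, rule allI)
  fix i
  obtain k where "N i \<le> k" "k < N (Suc i)" by (rule D_level)
  then show "N i < N (Suc i)" by simp
qed

lemma dom_X: "dom (X i) = level_product_between Ts (N i) (N (Suc i))"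
  by (rule var_words_betweenD(2)[OF words])

lemma X_var: "s \<in> listset (D i) \<Longrightarrow> X i s = Some (Var s)"
  by (rule var_words_betweenD(4)[OF words])

lemma X_symbol:
  assumes "X i t = Some y"
  shows "y \<in> Letter ` \<Lambda> \<union> Var ` listset (D i)"
  using var_words_betweenD(3)[OF words[of i]] ranI[of "X i", OF assms] by blast

lemma X_var_above:
  assumes "X i t = Some (Var s)"
  shows "(s, t) \<in> level_product_order Ts"
proof -
  have "s \<in> listset (D i)" using X_symbol[OF assms] by auto
  then show ?thesis using assms by (rule var_words_betweenD(5)[OF words])
qed

lemma X_occurrence_levels:
  "s \<in> listset (D i) \<Longrightarrow> s' \<in> listset (D i) \<Longrightarrow>
   level_product_levels Ts (occurrences (X i) s) = level_product_levels Ts (occurrences (X i) s')"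
  by (rule var_words_betweenD(6)[OF words])

lemma dom_X_unique:
  assumes "t \<in> dom (X i)" "t \<in> dom (X j)"
  shows "i = j"
proof -
  obtain k where k: "t \<in> listset (vlevel Ts k)"
    using assms(1) unfolding dom_X level_product_between_def by blast
  have "N i \<le> k" "k < N (Suc i)" "N j \<le> k" "k < N (Suc j)"
    using assms mem_level_product_between_iff[OF k] by (auto simp: dom_X)
  then have "N i < N (Suc j)" "N j < N (Suc i)" by auto
  then have "i < Suc j" "j < Suc i" using strict_mono_less[OF N_strict_mono] by blast+
  then show ?thesis by simp
qed

lemma Least_dom_X: "t \<in> dom (X i) \<Longrightarrow> (LEAST l. t \<in> dom (X l)) = i"
  by (rule dom_X_unique[OF LeastI])

lemma glue_eq_Some_iff:
  "glue X \<tau> m n t = Some y \<longleftrightarrow>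
   (\<exists>l\<in>{m..<n}. \<exists>z. X l t = Some z \<and> y = case_symbol Letter (\<tau> l) z)"
proof
  assume "glue X \<tau> m n t = Some y"
  then show "\<exists>l\<in>{m..<n}. \<exists>z. X l t = Some z \<and> y = case_symbol Letter (\<tau> l) z"
    by (auto simp: glue_def Let_def split: if_splits)
next
  assume "\<exists>l\<in>{m..<n}. \<exists>z. X l t = Some z \<and> y = case_symbol Letter (\<tau> l) z"
  then obtain l z where l: "l \<in> {m..<n}" "X l t = Some z" "y = case_symbol Letter (\<tau> l) z" by blast
  then have "(LEAST l. t \<in> dom (X l)) = l" by (intro Least_dom_X) auto
  then show "glue X \<tau> m n t = Some y" using l by (simp add: glue_def)
qed

lemma fill_eq_Some_iff:
  "fill X h n t = Some x \<longleftrightarrow>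
   (\<exists>l<n. \<exists>z. X l t = Some z \<and> x = (case z of Letter y \<Rightarrow> y | Var s \<Rightarrow> h l s))"
proof
  assume *: "fill X h n t = Some x"
  let ?l = "LEAST l. t \<in> dom (X l)"
  have "?l < n" and "subst_word (X ?l) (h ?l) t = Some x"
    using * by (simp_all add: fill_def Let_def split: if_splits)
  then show "\<exists>l<n. \<exists>z. X l t = Some z \<and> x = (case z of Letter y \<Rightarrow> y | Var s \<Rightarrow> h l s)"
    by (intro exI[of _ ?l]) (auto simp: subst_word_def)
next
  assume "\<exists>l<n. \<exists>z. X l t = Some z \<and> x = (case z of Letter y \<Rightarrow> y | Var s \<Rightarrow> h l s)"
  then obtain l z where l: "l < n" "X l t = Some z"
    "x = (case z of Letter y \<Rightarrow> y | Var s \<Rightarrow> h l s)" by blast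
  then have "(LEAST l. t \<in> dom (X l)) = l" by (intro Least_dom_X) auto
  then show "fill X h n t = Some x" using l by (simp add: fill_def subst_word_def)
qed

lemma UN_dom_X:
  assumes "m \<le> n"
  shows "(\<Union>l\<in>{m..<n}. dom (X l)) = level_product_between Ts (N m) (N n)"
  using assms
proof (induction n rule: dec_induct)
  case base
  then show ?case by (simp add: level_product_between_def)
next
  case (step n)
  have "N m \<le> N n" "N n \<le> N (Suc n)"
    using step strict_mono_less_eq[OF N_strict_mono] by auto
  then have "{N m..<N (Suc n)} = {N m..<N n} \<union> {N n..<N (Suc n)}" by auto
  moreover have "{m..<Suc n} = insert n {m..<n}" using step by auto
  ultimately show ?case
    using step.IH by (simp add: dom_X level_product_between_def Un_commute)
qed

lemma dom_fill: "dom (fill X h n) = level_product_between Ts 0 (N n)"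
proof -
  have "t \<in> dom (fill X h n) \<longleftrightarrow> (\<exists>l<n. t \<in> dom (X l))" for t
    unfolding dom_def mem_Collect_eq not_None_eq fill_eq_Some_iff by blast
  then have "dom (fill X h n) = (\<Union>l\<in>{0..<n}. dom (X l))"
    by (simp only: set_eq_iff UN_iff Bex_def atLeast0LessThan lessThan_iff) blast
  then show ?thesis using UN_dom_X[of 0 n] N0 by simp
qed

lemma fill_const_word:
  assumes "\<And>l s. l < n \<Longrightarrow> s \<in> listset (D l) \<Longrightarrow> h l s \<in> \<Lambda>"
  shows "fill X h n \<in> const_words \<Lambda> Ts"
proof -
  have "ran (fill X h n) \<subseteq> \<Lambda>"
  proof
    fix x assume "x \<in> ran (fill X h n)"
    then obtain t where "fill X h n t = Some x" by (auto simp: ran_def)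
    then obtain l y where l: "l < n" "X l t = Some y" "x = (case y of Letter x \<Rightarrow> x | Var s \<Rightarrow> h l s)"
      unfolding fill_eq_Some_iff by blast
    then show "x \<in> \<Lambda>" using X_symbol[OF l(2)] assms by (cases y) auto
  qed
  then have "fill X h n \<in> words_between \<Lambda> Ts 0 (N n)" by (simp add: words_between_def dom_fill)
  then show ?thesis unfolding const_words_def by blast
qed

lemma finite_span_iff:
  "w \<in> finite_span \<Lambda> Ts X q \<longleftrightarrow>
   (\<exists>h. (\<forall>l<q. \<forall>s\<in>listset (D l). h l s \<in> \<Lambda>) \<and> w = fill X h q)"
proof -
  have graph: "Map.graph w = (\<Union>i<q. Map.graph (subst_word (X i) (h i))) \<longleftrightarrow> w = fill X h q" for h
  proof -
    have "(\<Union>i<q. Map.graph (subst_word (X i) (h i))) = Map.graph (fill X h q)"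
    proof (intro set_eqI iffI)
      fix p assume "p \<in> (\<Union>i<q. Map.graph (subst_word (X i) (h i)))"
      then obtain i where "i < q" "subst_word (X i) (h i) (fst p) = Some (snd p)"
        by (auto simp: graph_def)
      then have "fill X h q (fst p) = Some (snd p)"
        unfolding fill_eq_Some_iff by (intro exI[of _ i]) (auto simp: subst_word_def)
      then show "p \<in> Map.graph (fill X h q)" by (simp add: graph_def split_beta)
    next
      fix p assume "p \<in> Map.graph (fill X h q)"
      then have "fill X h q (fst p) = Some (snd p)" by (auto simp: graph_def)
      then obtain i where "i < q" "subst_word (X i) (h i) (fst p) = Some (snd p)"
        unfolding fill_eq_Some_iff by (auto simp: subst_word_def)
      then show "p \<in> (\<Union>i<q. Map.graph (subst_word (X i) (h i)))"
        by (intro UN_I[of i]) (auto simp: graph_def)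
    qed
    moreover have "Map.graph w = Map.graph (fill X h q) \<longleftrightarrow> w = fill X h q"
    proof
      assume "Map.graph w = Map.graph (fill X h q)"
      then have "w t = Some x \<longleftrightarrow> fill X h q t = Some x" for t x
        unfolding graph_def by blast
      then show "w = fill X h q" by (intro ext option_eqI)
    qed simp
    ultimately show ?thesis by simp
  qed
  have span: "g \<in> word_span \<Lambda> Ts (X i) \<longleftrightarrow>
      (\<exists>a. g = subst_word (X i) a \<and> (\<forall>s\<in>listset (D i). a s \<in> \<Lambda>))" for g i
    unfolding word_span_def ws_eq[OF words[of i]] by blast
  show ?thesis
  proof
    assume "w \<in> finite_span \<Lambda> Ts X q"
    then obtain g where g: "\<forall>i<q. g i \<in> word_span \<Lambda> Ts (X i)"
      and w: "Map.graph w = (\<Union>i<q. Map.graph (g i))"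
      by (auto simp: finite_span_def)
    from g have "\<forall>i. \<exists>a. i < q \<longrightarrow> g i = subst_word (X i) a \<and> (\<forall>s\<in>listset (D i). a s \<in> \<Lambda>)"
      unfolding span by blast
    then obtain h where "\<forall>i. i < q \<longrightarrow> g i = subst_word (X i) (h i) \<and> (\<forall>s\<in>listset (D i). h i s \<in> \<Lambda>)"
      by (rule choice[THEN exE])
    then show "\<exists>h. (\<forall>l<q. \<forall>s\<in>listset (D l). h l s \<in> \<Lambda>) \<and> w = fill X h q"
      using w graph[of h] by (intro exI[of _ h]) simp
  next
    assume "\<exists>h. (\<forall>l<q. \<forall>s\<in>listset (D l). h l s \<in> \<Lambda>) \<and> w = fill X h q"
    then obtain h where "\<forall>l<q. \<forall>s\<in>listset (D l). h l s \<in> \<Lambda>" "w = fill X h q" by blast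
    then show "w \<in> finite_span \<Lambda> Ts X q"
      unfolding finite_span_def span using graph[of h]
      by (intro CollectI exI[of _ "\<lambda>i. subst_word (X i) (h i)"]) blast
  qed
qed

end

lemma (in infinite_vector_tree) subspace_iff:
  "subspace \<Lambda> Ts X \<longleftrightarrow>
   (\<exists>D N. word_sequence Ts \<Lambda> X D N \<and> (\<forall>i. vdominates Ts (D i) (vlevel Ts i)))"
proof
  assume X: "subspace \<Lambda> Ts X"
  define D where "D = (\<lambda>i. ws \<Lambda> Ts (X i))"
  define N where "N = (\<lambda>i. bot_level \<Lambda> Ts (X i))"
  have "X i \<in> var_words_between \<Lambda> Ts (D i) (N i) (N (Suc i))" for i
  proof -
    obtain E m n where f: "X i \<in> var_words_between \<Lambda> Ts E m n"
      using X unfolding subspace_def var_words_def by blast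
    have "N (Suc i) = top_level \<Lambda> Ts (X i)"
      using X by (simp add: subspace_def compatible_def N_def)
    then show ?thesis
      using f by (simp add: D_def N_def ws_eq[OF f] bot_level_eq[OF vt ih f] top_level_eq[OF vt ih f])
  qed
  moreover have "N 0 = 0" "\<forall>i. vdominates Ts (D i) (vlevel Ts i)"
    using X by (simp_all add: subspace_def N_def D_def)
  ultimately show "\<exists>D N. word_sequence Ts \<Lambda> X D N \<and> (\<forall>i. vdominates Ts (D i) (vlevel Ts i))"
    using infinite_vector_tree_axioms
    by (intro exI[of _ D] exI[of _ N]) (simp add: word_sequence_def word_sequence_axioms_def)
next
  assume "\<exists>D N. word_sequence Ts \<Lambda> X D N \<and> (\<forall>i. vdominates Ts (D i) (vlevel Ts i))"
  then obtain D N where "word_sequence Ts \<Lambda> X D N" and dom: "\<forall>i. vdominates Ts (D i) (vlevel Ts i)"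
    by blast
  then interpret word_sequence Ts \<Lambda> X D N by simp
  have "X i \<in> var_words \<Lambda> Ts" for i
    unfolding var_words_def using words[of i] by blast
  then show "subspace \<Lambda> Ts X"
    using dom N0
    by (simp add: subspace_def compatible_def ws_eq[OF words] bot_level_eq[OF vt ih words]
        top_level_eq[OF vt ih words])
qed

section \<open>Coarser sequences of variable words\<close>

lemma strict_mono_block:
  fixes n :: "nat \<Rightarrow> nat"
  assumes "strict_mono n" "n 0 = 0"
  shows "\<exists>!i. n i \<le> l \<and> l < n (Suc i)"
proof (rule ex_ex1I)
  show "\<exists>i. n i \<le> l \<and> l < n (Suc i)"
  proof (induction l)
    case 0
    then show ?case using assms strict_monoD[OF assms(1), of 0 1] by (intro exI[of _ 0]) simp
  next
    case (Suc l)
    then obtain i where i: "n i \<le> l" "l < n (Suc i)" by blast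
    show ?case
    proof (cases "Suc l < n (Suc i)")
      case True
      then show ?thesis using i by (intro exI[of _ i]) simp
    next
      case False
      then show ?thesis
        using i strict_monoD[OF assms(1), of "Suc i" "Suc (Suc i)"] by (intro exI[of _ "Suc i"]) simp
    qed
  qed
next
  fix i j assume "n i \<le> l \<and> l < n (Suc i)" "n j \<le> l \<and> l < n (Suc j)"
  then have "n i < n (Suc j)" "n j < n (Suc i)" by auto
  then have "i < Suc j" "j < Suc i" using strict_mono_less[OF assms(1)] by blast+
  then show "i = j" by simp
qed

context word_sequence
begin

lemma dom_glue:
  assumes "m \<le> n"
  shows "dom (glue X \<tau> m n) = level_product_between Ts (N m) (N n)"
proof -
  have "t \<in> dom (glue X \<tau> m n) \<longleftrightarrow> (\<exists>l\<in>{m..<n}. t \<in> dom (X l))" for t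
    unfolding dom_def mem_Collect_eq not_None_eq glue_eq_Some_iff by blast
  then have "dom (glue X \<tau> m n) = (\<Union>l\<in>{m..<n}. dom (X l))"
    by (simp only: set_eq_iff UN_iff) blast
  then show ?thesis using UN_dom_X[OF assms] by simp
qed

text \<open>
  Conditions on a substitution under which the words \<open>X m, \<dots>, X (n - 1)\<close> glue to a variable word
  with vector level subset \<open>E\<close>. The index \<open>k\<close> is that of the word in which the new variables first
  occur; there the variables indexed by \<open>E\<close> are kept. Every variable is replaced by a letter or by a new
  variable whose index lies below its own, which keeps the index the minimum of its occurrences.
  Finally, a word that contains one of the new variables has to contain all of them, so that they
  occur on the same levels.
\<close>

definition admissible ::
    "(nat \<Rightarrow> 'a list \<Rightarrow> ('l, 'a) symbol) \<Rightarrow> 'a set list \<Rightarrow> nat \<Rightarrow> nat \<Rightarrow> bool" where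
  "admissible \<tau> E m n \<longleftrightarrow>
     (\<exists>k. m \<le> k \<and> k < n \<and> length E = length Ts \<and>
        (\<forall>r<length Ts. E ! r \<noteq> {} \<and> E ! r \<subseteq> D k ! r) \<and>
        (\<forall>u\<in>listset E. \<tau> k u = Var u)) \<and>
     (\<forall>l\<in>{m..<n}. \<forall>s\<in>listset (D l).
        \<tau> l s \<in> Letter ` \<Lambda> \<union> Var ` listset E \<and>
        (\<forall>u. \<tau> l s = Var u \<longrightarrow> (u, s) \<in> level_product_order Ts \<and>
           (\<forall>u'\<in>listset E. \<exists>s'\<in>listset (D l). \<tau> l s' = Var u')))"

text \<open>
  Occurrences of a new variable \<open>v\<^sub>u\<close> are the occurrences of those old variables \<open>v\<^sub>s\<close> that are replaced
  by it, and within one word \<open>X l\<close> all old variables occupy the same levels.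
\<close>

lemma glue_var_word:
  assumes "admissible \<tau> E m n"
  shows "glue X \<tau> m n \<in> var_words_between \<Lambda> Ts E (N m) (N n)"
proof -
  let ?Y = "glue X \<tau> m n"
  obtain k where k: "m \<le> k" "k < n" and lenE: "length E = length Ts"
    and E: "\<And>r. r < length Ts \<Longrightarrow> E ! r \<noteq> {} \<and> E ! r \<subseteq> D k ! r"
    and first: "\<And>u. u \<in> listset E \<Longrightarrow> \<tau> k u = Var u"
    using assms unfolding admissible_def by blast
  have sym: "\<tau> l s \<in> Letter ` \<Lambda> \<union> Var ` listset E"
    and above: "\<And>u. \<tau> l s = Var u \<Longrightarrow> (u, s) \<in> level_product_order Ts"
    and unif: "\<And>u u'. \<lbrakk>\<tau> l s = Var u; u' \<in> listset E\<rbrakk> \<Longrightarrow> \<exists>s'\<in>listset (D l). \<tau> l s' = Var u'"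
    if "m \<le> l" "l < n" "s \<in> listset (D l)" for l s
  proof -
    have "l \<in> {m..<n}" using that by simp
    with assms that(3) show "\<tau> l s \<in> Letter ` \<Lambda> \<union> Var ` listset E"
      and "\<And>u. \<tau> l s = Var u \<Longrightarrow> (u, s) \<in> level_product_order Ts"
      and "\<And>u u'. \<lbrakk>\<tau> l s = Var u; u' \<in> listset E\<rbrakk> \<Longrightarrow> \<exists>s'\<in>listset (D l). \<tau> l s' = Var u'"
      unfolding admissible_def by blast+
  qed
  obtain j where j: "N k \<le> j" "j < N (Suc k)" "vector_level_subset Ts j (D k)" by (rule D_level)
  have "N m \<le> N k" "N (Suc k) \<le> N n"
    using k strict_mono_less_eq[OF N_strict_mono] by auto
  then have j_mem: "j \<in> {N m..<N n}" using j by simp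
  have "E ! r \<subseteq> level (Ts ! r) j" if "r < length Ts" for r
    using E[OF that] j(3) that by (auto simp: vector_level_subset_def)
  then have level: "vector_level_subset Ts j E"
    using E lenE by (simp add: vector_level_subset_def)
  have ED: "listset E \<subseteq> listset (D k)"
  proof
    fix s assume s: "s \<in> listset E"
    have "s ! r \<in> D k ! r" if "r < length Ts" for r
      using E[OF that] s lenE that by (auto simp: listset_iff)
    then show "s \<in> listset (D k)"
      using s lenE j(3) by (simp add: listset_iff vector_level_subset_def)
  qed
  have occ: "?Y t = Some (Var u) \<longleftrightarrow>
      (\<exists>l s. m \<le> l \<and> l < n \<and> s \<in> listset (D l) \<and> \<tau> l s = Var u \<and> X l t = Some (Var s))" for t u
  proof
    assume "?Y t = Some (Var u)"
    then obtain l z where l: "m \<le> l" "l < n" "X l t = Some z" "Var u = case_symbol Letter (\<tau> l) z"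
      unfolding glue_eq_Some_iff by auto
    then show "\<exists>l s. m \<le> l \<and> l < n \<and> s \<in> listset (D l) \<and> \<tau> l s = Var u \<and> X l t = Some (Var s)"
      using X_symbol[OF l(3)] by (cases z) auto
  next
    assume "\<exists>l s. m \<le> l \<and> l < n \<and> s \<in> listset (D l) \<and> \<tau> l s = Var u \<and> X l t = Some (Var s)"
    then show "?Y t = Some (Var u)" unfolding glue_eq_Some_iff by force
  qed
  have "dom ?Y = level_product_between Ts (N m) (N n)" using k by (intro dom_glue) simp
  moreover have "ran ?Y \<subseteq> Letter ` \<Lambda> \<union> Var ` listset E"
  proof
    fix y assume "y \<in> ran ?Y"
    then obtain t where "?Y t = Some y" by (auto simp: ran_def)
    then obtain l z where l: "m \<le> l" "l < n" "X l t = Some z" "y = case_symbol Letter (\<tau> l) z"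
      unfolding glue_eq_Some_iff by auto
    show "y \<in> Letter ` \<Lambda> \<union> Var ` listset E"
    proof (cases z)
      case (Letter x)
      then show ?thesis using l(4) X_symbol[OF l(3)] by auto
    next
      case (Var s)
      then show ?thesis using l(4) X_symbol[OF l(3)] sym[OF l(1,2), of s] by auto
    qed
  qed
  moreover have "u \<in> occurrences ?Y u \<and> (\<forall>t\<in>occurrences ?Y u. (u, t) \<in> level_product_order Ts)"
    if u: "u \<in> listset E" for u
  proof
    show "u \<in> occurrences ?Y u"
      unfolding occurrences_def mem_Collect_eq occ
      using k first[OF u] ED u X_var[of u k] by blast
    show "\<forall>t\<in>occurrences ?Y u. (u, t) \<in> level_product_order Ts"
    proof
      fix t assume "t \<in> occurrences ?Y u"
      then obtain l s where "m \<le> l" "l < n" "s \<in> listset (D l)" "\<tau> l s = Var u" "X l t = Some (Var s)"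
        unfolding occurrences_def mem_Collect_eq occ by blast
      then show "(u, t) \<in> level_product_order Ts"
        using product_order_trans[OF above[of l s u] X_var_above[of l t s]] by blast
    qed
  qed
  moreover have "level_product_levels Ts (occurrences ?Y u) = level_product_levels Ts (occurrences ?Y u')"
    if "u \<in> listset E" "u' \<in> listset E" for u u'
  proof -
    have "level_product_levels Ts (occurrences ?Y u) \<subseteq> level_product_levels Ts (occurrences ?Y u')"
      if u': "u' \<in> listset E" for u u'
    proof
      fix i assume "i \<in> level_product_levels Ts (occurrences ?Y u)"
      then obtain t where t: "t \<in> listset (vlevel Ts i)" "?Y t = Some (Var u)"
        by (auto simp: level_product_levels_def occurrences_def)
      then obtain l s where l: "m \<le> l" "l < n" and s: "s \<in> listset (D l)" "\<tau> l s = Var u"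
        "X l t = Some (Var s)" unfolding occ by blast
      obtain s' where s': "s' \<in> listset (D l)" "\<tau> l s' = Var u'"
        using unif[OF l s(1,2) u'] by blast
      have "i \<in> level_product_levels Ts (occurrences (X l) s)"
        using t(1) s(3) by (auto simp: level_product_levels_def occurrences_def)
      then have "i \<in> level_product_levels Ts (occurrences (X l) s')"
        using X_occurrence_levels[OF s(1) s'(1)] by simp
      then obtain t' where "t' \<in> listset (vlevel Ts i)" "X l t' = Some (Var s')"
        by (auto simp: level_product_levels_def occurrences_def)
      moreover from this have "?Y t' = Some (Var u')" unfolding occ using l s' by blast
      ultimately show "i \<in> level_product_levels Ts (occurrences ?Y u')"
        by (auto simp: level_product_levels_def occurrences_def)
    qed
    then show ?thesis using that by (intro subset_antisym)
  qed
  ultimately show ?thesis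
    unfolding var_words_between_def mem_Collect_eq using level j_mem
    by (intro conjI ballI bexI[of _ j]) blast+
qed

lemma word_sequence_glue:
  assumes "n 0 = 0" "\<And>i. admissible (\<tau> i) (E i) (n i) (n (Suc i))"
  shows "word_sequence Ts \<Lambda> (\<lambda>i. glue X (\<tau> i) (n i) (n (Suc i))) E (\<lambda>i. N (n i))"
  using infinite_vector_tree_axioms glue_var_word[OF assms(2)] assms(1) N0
  by (simp add: word_sequence_def word_sequence_axioms_def)

text \<open>
  Filling the variables of the glued words amounts to filling those of the original words, by
  composition of the substitutions. Hence gluing yields smaller subspaces.
\<close>

lemma fill_glue:
  assumes n: "strict_mono n" "n 0 = 0" and adm: "\<And>i. admissible (\<tau> i) (E i) (n i) (n (Suc i))"
    and H: "\<And>i l s. \<lbrakk>i < q; n i \<le> l; l < n (Suc i); s \<in> listset (D l)\<rbrakk>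
              \<Longrightarrow> H l s = (case \<tau> i l s of Letter x \<Rightarrow> x | Var u \<Rightarrow> h i u)"
  shows "fill (\<lambda>i. glue X (\<tau> i) (n i) (n (Suc i))) h q = fill X H (n q)"
proof (intro ext option_eqI)
  fix t x
  let ?Y = "\<lambda>i. glue X (\<tau> i) (n i) (n (Suc i))"
  interpret Y: word_sequence Ts \<Lambda> ?Y E "\<lambda>i. N (n i)"
    using n(2) adm by (rule word_sequence_glue)
  have eval: "(case case_symbol Letter (\<tau> i l) z of Letter y \<Rightarrow> y | Var u \<Rightarrow> h i u) =
      (case z of Letter y \<Rightarrow> y | Var s \<Rightarrow> H l s)"
    if "i < q" "n i \<le> l" "l < n (Suc i)" "X l t = Some z" for i l z
  proof (cases z)
    case (Var s)
    then have "s \<in> listset (D l)" using X_symbol[OF that(4)] by auto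
    then show ?thesis using H[OF that(1-3)] Var by simp
  qed simp
  show "fill ?Y h q t = Some x \<longleftrightarrow> fill X H (n q) t = Some x"
  proof
    assume "fill ?Y h q t = Some x"
    then obtain i y where i: "i < q" "?Y i t = Some y"
      and x: "x = (case y of Letter y \<Rightarrow> y | Var u \<Rightarrow> h i u)"
      unfolding Y.fill_eq_Some_iff by blast
    then obtain l z where l: "n i \<le> l" "l < n (Suc i)" "X l t = Some z"
      and y: "y = case_symbol Letter (\<tau> i l) z"
      unfolding glue_eq_Some_iff by auto
    have "n (Suc i) \<le> n q" using i(1) strict_mono_less_eq[OF n(1)] by simp
    then have "l < n q" using l(2) by simp
    then show "fill X H (n q) t = Some x"
      unfolding fill_eq_Some_iff using l(3) eval[OF i(1) l] x y by blast
  next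
    assume "fill X H (n q) t = Some x"
    then obtain l z where l: "l < n q" "X l t = Some z"
      and x: "x = (case z of Letter y \<Rightarrow> y | Var s \<Rightarrow> H l s)"
      unfolding fill_eq_Some_iff by blast
    obtain i where i: "n i \<le> l" "l < n (Suc i)" using strict_mono_block[OF n] by blast
    then have "n i < n q" using l(1) by simp
    then have "i < q" using strict_mono_less[OF n(1)] by blast
    moreover have "?Y i t = Some (case_symbol Letter (\<tau> i l) z)"
      unfolding glue_eq_Some_iff using i l(2) by auto
    ultimately show "fill ?Y h q t = Some x"
      unfolding Y.fill_eq_Some_iff using eval[OF _ i l(2)] x by metis
  qed
qed

lemma subspace_le_glue:
  assumes n: "strict_mono n" "n 0 = 0" and adm: "\<And>i. admissible (\<tau> i) (E i) (n i) (n (Suc i))"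
  shows "subspace_le \<Lambda> Ts (\<lambda>i. glue X (\<tau> i) (n i) (n (Suc i))) X"
  unfolding subspace_le_def
proof
  let ?Y = "\<lambda>i. glue X (\<tau> i) (n i) (n (Suc i))"
  interpret Y: word_sequence Ts \<Lambda> ?Y E "\<lambda>i. N (n i)"
    using n(2) adm by (rule word_sequence_glue)
  fix w assume "w \<in> seq_span \<Lambda> Ts ?Y"
  then obtain q where q: "q \<ge> 1" and "w \<in> finite_span \<Lambda> Ts ?Y q"
    by (auto simp: seq_span_def)
  then obtain h where h: "\<forall>i<q. \<forall>u\<in>listset (E i). h i u \<in> \<Lambda>" and w: "w = fill ?Y h q"
    unfolding Y.finite_span_iff by blast
  define b where "b = (\<lambda>l. THE i. n i \<le> l \<and> l < n (Suc i))"
  have b: "b l = i" if "n i \<le> l" "l < n (Suc i)" for i l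
    unfolding b_def using strict_mono_block[OF n] that by (intro the1_equality conjI)
  define H where "H = (\<lambda>l s. case \<tau> (b l) l s of Letter x \<Rightarrow> x | Var u \<Rightarrow> h (b l) u)"
  have wH: "w = fill X H (n q)"
    unfolding w using n adm by (rule fill_glue) (simp add: H_def b split: symbol.split)
  have H_val: "H l s \<in> \<Lambda>" if "l < n q" "s \<in> listset (D l)" for l s
  proof -
    obtain i where i: "n i \<le> l" "l < n (Suc i)" using strict_mono_block[OF n] by blast
    then have "n i < n q" using that(1) by simp
    then have "i < q" using strict_mono_less[OF n(1)] by blast
    have "\<tau> i l s \<in> Letter ` \<Lambda> \<union> Var ` listset (E i)"
      using adm[of i] i that(2) unfolding admissible_def by simp
    then show ?thesis using h \<open>i < q\<close> b[OF i] by (auto simp: H_def)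
  qed
  have "w \<in> finite_span \<Lambda> Ts X (n q)"
    unfolding finite_span_iff
    by (rule exI[of _ H], rule conjI[OF _ wH]) (intro allI impI ballI H_val)
  moreover have "n q \<in> {1..}" using q strict_monoD[OF n(1), of 0 q] by simp
  ultimately show "w \<in> seq_span \<Lambda> Ts X"
    unfolding seq_span_def by (rule UN_I[rotated])
qed

end

section \<open>Passing to a sequence with increasing vector level subsets\<close>

text \<open>
  If \<open>D l\<close> lies on level \<open>k\<close>, the next word whose variables are kept is \<open>X (k + 1)\<close>: its vector level
  subset dominates level \<open>k + 1\<close> of the trees and therefore everything on level \<open>k\<close>. In the words
  between, the letter \<open>z\<close> is substituted for all variables.
\<close>

lemma (in word_sequence) dominating_subsequence:
  assumes dom: "\<And>i. vdominates Ts (D i) (vlevel Ts i)" and z: "z \<in> \<Lambda>"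
  obtains Y E M where "word_sequence Ts \<Lambda> Y E M" "subspace_le \<Lambda> Ts Y X"
    "\<And>i. vdominates Ts (E i) (vlevel Ts i)" "\<And>i. vdominates Ts (E (Suc i)) (E i)"
proof -
  have "\<exists>lev. \<forall>i. N i \<le> lev i \<and> vector_level_subset Ts (lev i) (D i)"
    using D_level by (intro choice allI) blast
  then obtain lev where lev: "\<And>i. N i \<le> lev i" "\<And>i. vector_level_subset Ts (lev i) (D i)"
    by blast
  define n where "n = rec_nat 0 (\<lambda>_ m. Suc (lev m))"
  have n0: "n 0 = 0" and nS: "n (Suc i) = Suc (lev (n i))" for i by (simp_all add: n_def)
  have "n i < n (Suc i)" for i
    using lev(1)[of "n i"] strict_mono_imp_increasing[OF N_strict_mono, of "n i"] by (simp add: nS)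
  then have n: "strict_mono n" by (simp add: strict_mono_Suc_iff)
  define \<tau> where "\<tau> = (\<lambda>l s. if l \<in> range n then Var s else Letter z :: ('l, 'a) symbol)"
  have adm: "admissible \<tau> (D (n i)) (n i) (n (Suc i))" for i
    unfolding admissible_def
  proof (intro conjI exI[of _ "n i"] ballI allI impI)
    show "n i < n (Suc i)" using n by (simp add: strict_mono_Suc_iff)
    show "length (D (n i)) = length Ts" "\<And>r. r < length Ts \<Longrightarrow> D (n i) ! r \<noteq> {}"
      using lev(2)[of "n i"] by (simp_all add: vector_level_subset_def)
    fix l s assume l: "l \<in> {n i..<n (Suc i)}" and s: "s \<in> listset (D l)"
    have l_eq: "l = n i" if l_range: "l \<in> range n"
    proof -
      obtain j where j: "l = n j" using l_range by blast
      then have "n j < n (Suc i)" "n i < n (Suc j)" using l strict_monoD[OF n, of j "Suc j"] by auto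
      then have "j < Suc i" "i < Suc j" using strict_mono_less[OF n] by blast+
      then show ?thesis using j by (metis le_antisym less_Suc_eq_le)
    qed
    show "\<tau> l s \<in> Letter ` \<Lambda> \<union> Var ` listset (D (n i))"
      using z s l_eq by (auto simp: \<tau>_def)
    fix u assume u: "\<tau> l s = Var u"
    have "s \<in> level_product Ts"
      using s vector_level_subset_sub[OF lev(2)[of l]] by (auto simp: level_product_def)
    moreover have "u = s" "l \<in> range n" using u by (auto simp: \<tau>_def split: if_splits)
    ultimately show "(u, s) \<in> level_product_order Ts" using product_order_refl by simp
    fix u' assume "u' \<in> listset (D (n i))"
    then show "\<exists>s'\<in>listset (D l). \<tau> l s' = Var u'"
      using l_eq \<open>l \<in> range n\<close> by (intro bexI[of _ u']) (auto simp: \<tau>_def)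
  qed (auto simp: \<tau>_def)
  show thesis
  proof (rule that)
    show "word_sequence Ts \<Lambda> (\<lambda>i. glue X \<tau> (n i) (n (Suc i))) (\<lambda>i. D (n i)) (\<lambda>i. N (n i))"
      using n0 adm by (rule word_sequence_glue)
    show "subspace_le \<Lambda> Ts (\<lambda>i. glue X \<tau> (n i) (n (Suc i))) X"
      using n n0 adm by (rule subspace_le_glue)
    show "vdominates Ts (D (n i)) (vlevel Ts i)" for i
      using vdominates_trans[OF dom vdominates_vlevel[OF strict_mono_imp_increasing[OF n]]] .
    show "vdominates Ts (D (n (Suc i))) (D (n i))" for i
    proof (rule vdominates_mono)
      show "vdominates Ts (D (n (Suc i))) (vlevel Ts (lev (n i)))"
        by (rule vdominates_trans[OF dom vdominates_vlevel]) (simp add: nS)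
      show "D (n i) ! r \<subseteq> vlevel Ts (lev (n i)) ! r" if "r < length Ts" for r
        using lev(2)[of "n i"] that by (simp add: vector_level_subset_def vlevel_def)
    qed
  qed
qed

section \<open>Branches through the vector level subsets\<close>

locale branching_sequence = word_sequence Ts \<Lambda> X D N
  for Ts :: "'a rel list" and \<Lambda> :: "'l set" and X :: "nat \<Rightarrow> ('l, 'a) vword"
    and D :: "nat \<Rightarrow> 'a set list" and N :: "nat \<Rightarrow> nat" +
  assumes chain: "\<And>i. vdominates Ts (D (Suc i)) (D i)"
begin

text \<open>
  The infinite branch through a node \<open>u\<close> of \<open>D i ! r\<close>, traced by its nodes in \<open>D l ! r\<close> for \<open>l \<ge> i\<close>. It
  is constant up to \<open>l = i\<close>, which lets the recursion on \<open>l\<close> begin at \<open>0\<close>.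
\<close>

primrec branch :: "nat \<Rightarrow> nat \<Rightarrow> nat \<Rightarrow> 'a \<Rightarrow> 'a" where
  "branch r i 0 u = u"
| "branch r i (Suc l) u =
     (if Suc l \<le> i then u else SOME v. v \<in> D (Suc l) ! r \<and> (branch r i l u, v) \<in> Ts ! r)"

lemma branch_start: "l \<le> i \<Longrightarrow> branch r i l u = u"
  by (cases l) auto

lemma branch_step:
  assumes "r < length Ts" "i \<le> l" "branch r i l u \<in> D l ! r"
  shows "branch r i (Suc l) u \<in> D (Suc l) ! r \<and> (branch r i l u, branch r i (Suc l) u) \<in> Ts ! r"
proof -
  have "\<exists>v. v \<in> D (Suc l) ! r \<and> (branch r i l u, v) \<in> Ts ! r"
    using chain[of l] assms by (auto simp: vdominates_def dominates_def)
  from someI_ex[OF this] show ?thesis using assms(2) by simp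
qed

lemma branch_in:
  assumes "r < length Ts" "u \<in> D i ! r" "i \<le> l"
  shows "branch r i l u \<in> D l ! r"
  using assms(3)
proof (induction l rule: dec_induct)
  case base
  then show ?case using assms by (simp add: branch_start)
next
  case (step l)
  then show ?case using branch_step[OF assms(1)] by blast
qed

lemma D_nth_level:
  assumes "r < length Ts"
  obtains k where "D i ! r \<subseteq> level (Ts ! r) k"
  using D_level[of i] assms unfolding vector_level_subset_def by metis

lemma branch_mono:
  assumes "r < length Ts" "u \<in> D i ! r" "i \<le> l" "l \<le> l'"
  shows "(branch r i l u, branch r i l' u) \<in> Ts ! r"
  using assms(4)
proof (induction l' rule: dec_induct)
  case base
  obtain k where "D l ! r \<subseteq> level (Ts ! r) k" using assms(1) by (rule D_nth_level)
  then have "branch r i l u \<in> Field (Ts ! r)" using branch_in[OF assms(1-3)] by (auto simp: level_def)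
  then show ?case by (rule tree_refl[OF tree_nth[OF assms(1)]])
next
  case (step l')
  then have "i \<le> l'" using assms(3) by simp
  then have "(branch r i l' u, branch r i (Suc l') u) \<in> Ts ! r"
    using branch_step[OF assms(1) _ branch_in[OF assms(1,2)]] by blast
  with step.IH show ?case by (rule tree_trans[OF tree_nth[OF assms(1)]])
qed

text \<open>
  The values of the two branches at \<open>l\<close> lie above \<open>u\<close> and \<open>u'\<close>, and a node has only one
  predecessor on the level of \<open>D i ! r\<close>.
\<close>

lemma branch_inj:
  assumes "r < length Ts" "u \<in> D i ! r" "u' \<in> D i ! r" "i \<le> l" "branch r i l u = branch r i l u'"
  shows "u = u'"
proof -
  obtain k where "D i ! r \<subseteq> level (Ts ! r) k" using assms(1) by (rule D_nth_level)
  then have "u \<in> level (Ts ! r) k" "u' \<in> level (Ts ! r) k" using assms(2,3) by auto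
  moreover have "(u, branch r i l u) \<in> Ts ! r"
    using branch_mono[OF assms(1,2) order_refl assms(4)] by (simp add: branch_start)
  moreover have "(u', branch r i l u) \<in> Ts ! r"
    using branch_mono[OF assms(1,3) order_refl assms(4)] assms(5) by (simp add: branch_start)
  ultimately show ?thesis by (rule tree_level_unique_below[OF tree_nth[OF assms(1)]])
qed

definition vbranch :: "nat \<Rightarrow> nat \<Rightarrow> 'a list \<Rightarrow> 'a list" where
  "vbranch i l s = map (\<lambda>r. branch r i l (s ! r)) [0..<length Ts]"

definition branch_nodes :: "nat \<Rightarrow> nat \<Rightarrow> 'a set list" where
  "branch_nodes i l = map (\<lambda>r. branch r i l ` (D i ! r)) [0..<length Ts]"

lemma length_D: "length (D i) = length Ts"
  using D_level[of i] unfolding vector_level_subset_def by metis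

lemma vbranch_in:
  "s \<in> listset (D i) \<Longrightarrow> i \<le> l \<Longrightarrow> vbranch i l s \<in> listset (D l)"
  by (auto simp: listset_iff length_D vbranch_def branch_in)

lemma listset_D_level_product: "listset (D i) \<subseteq> level_product Ts"
proof -
  obtain k where "vector_level_subset Ts k (D i)" using D_level .
  from vector_level_subset_sub[OF this] show ?thesis by (auto simp: level_product_def)
qed

lemma vbranch_mono:
  assumes "s \<in> listset (D i)" "i \<le> l" "l \<le> l'"
  shows "(vbranch i l s, vbranch i l' s) \<in> level_product_order Ts"
proof -
  have "vbranch i l s \<in> level_product Ts" "vbranch i l' s \<in> level_product Ts"
    using vbranch_in[OF assms(1)] assms(2,3) listset_D_level_product by (meson order_trans subsetD)+
  moreover have "(vbranch i l s ! r, vbranch i l' s ! r) \<in> Ts ! r" if "r < length Ts" for r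
    using branch_mono[OF that _ assms(2,3)] assms(1) that
    by (simp add: vbranch_def listset_iff length_D)
  ultimately show ?thesis by (simp add: level_product_order_def)
qed

lemma vbranch_inj:
  assumes "i \<le> l"
  shows "inj_on (vbranch i l) (listset (D i))"
proof (rule inj_onI)
  fix s s' assume s: "s \<in> listset (D i)" "s' \<in> listset (D i)" and eq: "vbranch i l s = vbranch i l s'"
  show "s = s'"
  proof (rule nth_equalityI)
    show "length s = length s'" using s by (simp add: listset_iff)
    fix r assume "r < length s"
    then have r: "r < length Ts" using s by (simp add: listset_iff length_D)
    then have "branch r i l (s ! r) = branch r i l (s' ! r)"
      using arg_cong[OF eq, of "\<lambda>x. x ! r"] by (simp add: vbranch_def)
    then show "s ! r = s' ! r"
      using branch_inj[OF r _ _ assms] s r by (simp add: listset_iff length_D)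
  qed
qed

lemma listset_branch_nodes: "listset (branch_nodes i l) = vbranch i l ` listset (D i)"
proof (intro set_eqI iffI)
  fix t assume t: "t \<in> listset (branch_nodes i l)"
  then have "\<forall>r. \<exists>u. r < length Ts \<longrightarrow> u \<in> D i ! r \<and> t ! r = branch r i l u"
    by (auto simp: listset_iff branch_nodes_def)
  then obtain f where f: "\<forall>r. r < length Ts \<longrightarrow> f r \<in> D i ! r \<and> t ! r = branch r i l (f r)"
    by (rule choice[THEN exE])
  have "map f [0..<length Ts] \<in> listset (D i)" using f by (simp add: listset_iff length_D)
  moreover have "t = vbranch i l (map f [0..<length Ts])"
    using t f by (intro nth_equalityI) (simp_all add: vbranch_def listset_iff branch_nodes_def)
  ultimately show "t \<in> vbranch i l ` listset (D i)" by blast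
next
  fix t assume "t \<in> vbranch i l ` listset (D i)"
  then show "t \<in> listset (branch_nodes i l)"
    by (auto simp: listset_iff vbranch_def branch_nodes_def length_D)
qed

lemma branch_nodes_dominate:
  assumes "i \<le> l"
  shows "vdominates Ts (branch_nodes i l) (D i)"
  unfolding vdominates_def dominates_def
proof (intro allI impI ballI)
  fix r u assume r: "r < length Ts" and u: "u \<in> D i ! r"
  have "(u, branch r i l u) \<in> Ts ! r"
    using branch_mono[OF r u order_refl assms] by (simp add: branch_start)
  then show "\<exists>v\<in>branch_nodes i l ! r. (u, v) \<in> Ts ! r"
    using r u by (intro bexI[of _ "branch r i l u"]) (simp_all add: branch_nodes_def)
qed

end

section \<open>Monochromatic subspaces\<close>

text \<open>
  A letter of the auxiliary alphabet prescribes, for every index \<open>l\<close>, a substitution for the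
  variables of \<open>X l\<close>. The letters in \<open>A i\<close> come from vectors \<open>a\<close> on the product of \<open>D i\<close>, written at \<open>l\<close>
  along the branches that start in \<open>D i\<close>; off these branches the letter \<open>z\<close> is written. Thus a word
  \<open>w\<close> over the alphabet describes the constant word \<open>\<Phi> w\<close>. The \<open>i\<close>-th word \<open>w i\<close> of the Hales-Jewett
  theorem occupies the indices from \<open>n i\<close> to \<open>n (Suc i) - 1\<close>. Since \<open>i \<le> n i\<close>, the branches from \<open>D i\<close> are
  defined there, and gluing with the substitution \<open>\<tau> i\<close> read off from \<open>w i\<close> gives the \<open>i\<close>-th word of the
  subspace.
\<close>

lemma (in branching_sequence) monochromatic_subspace:
  fixes c :: "('l, 'a) cword \<Rightarrow> 'c"
  assumes dom: "\<And>i. vdominates Ts (D i) (vlevel Ts i)" and z: "z \<in> \<Lambda>" and fin: "finite \<Lambda>"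
    and col: "finite (c ` const_words \<Lambda> Ts)"
  obtains Y where "subspace \<Lambda> Ts Y" "subspace_le \<Lambda> Ts Y X" "monochromatic c (seq_span \<Lambda> Ts Y)"
proof -
  let ?P = "\<lambda>i. listset (D i)"
  let ?inv = "\<lambda>i l. inv_into (listset (D i)) (vbranch i l)"
  define letter where
    "letter = (\<lambda>i a l s. if s \<in> vbranch i l ` ?P i then a (?inv i l s) else z)"
  define A where "A = (\<lambda>i. letter i ` (?P i \<rightarrow>\<^sub>E \<Lambda>))"
  have A_val: "b l s \<in> \<Lambda>" if b: "b \<in> A i" for b i l s
  proof -
    obtain a where a: "a \<in> ?P i \<rightarrow>\<^sub>E \<Lambda>" "b = letter i a" using b by (auto simp: A_def)
    show ?thesis
    proof (cases "s \<in> vbranch i l ` ?P i")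
      case True
      then have "a (?inv i l s) \<in> \<Lambda>" by (intro PiE_mem[OF a(1)] inv_into_into)
      then show ?thesis using True a(2) by (simp add: letter_def)
    qed (use a(2) z in \<open>simp add: letter_def\<close>)
  qed
  define \<Phi> where "\<Phi> = (\<lambda>w. fill X (\<lambda>l s. (w ! l) l s) (length w))"
  obtain w k where w_var: "\<And>i. None \<in> set (w i)"
    and w_letters: "\<And>i. set (w i) \<subseteq> insert None (Some ` (\<Union>i. A i))"
    and mono: "\<And>q a. \<lbrakk>q \<ge> 1; \<And>i. i < q \<Longrightarrow> a i \<in> A i\<rbrakk>
       \<Longrightarrow> (c \<circ> \<Phi>) (concat (map (\<lambda>i. plug (a i) (w i)) [0..<q])) = k"
  proof (rule infinite_hales_jewett[of A "c \<circ> \<Phi>"])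
    fix i
    obtain j where "vector_level_subset Ts j (D i)" using D_level .
    then have "finite (?P i)" by (rule finite_listset)
    then show "finite (A i)" unfolding A_def using fin by (intro finite_imageI finite_PiE)
  next
    have "\<Phi> w \<in> const_words \<Lambda> Ts" if "w \<in> lists (\<Union>i. A i)" for w
      unfolding \<Phi>_def
    proof (rule fill_const_word)
      fix l s assume "l < length w"
      then have "w ! l \<in> (\<Union>i. A i)" using that nth_mem by (auto simp: in_lists_conv_set)
      then show "(w ! l) l s \<in> \<Lambda>" using A_val by blast
    qed
    then have "(c \<circ> \<Phi>) ` lists (\<Union>i. A i) \<subseteq> c ` const_words \<Lambda> Ts" by auto
    then show "finite ((c \<circ> \<Phi>) ` lists (\<Union>i. A i))" using col by (rule finite_subset)
  qed blast
  define n where "n = (\<lambda>i. \<Sum>j<i. length (w j))"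
  have n0: "n 0 = 0" and nS: "n (Suc i) = n i + length (w i)" for i by (simp_all add: n_def)
  have "length (w i) > 0" for i using w_var[of i] by (cases "w i") auto
  then have n: "strict_mono n" by (simp add: strict_mono_Suc_iff nS)
  have le_n: "i \<le> n i" for i using n by (rule strict_mono_imp_increasing)
  define pos where "pos = (\<lambda>i. LEAST p. p < length (w i) \<and> w i ! p = None)"
  have pos: "pos i < length (w i) \<and> w i ! pos i = None" for i
  proof -
    have "\<exists>p. p < length (w i) \<and> w i ! p = None" using w_var[of i] by (simp add: in_set_conv_nth)
    then show ?thesis unfolding pos_def by (rule LeastI_ex)
  qed
  have pos_le: "pos i \<le> p" if "p < length (w i)" "w i ! p = None" for i p
    unfolding pos_def using that by (intro Least_le) simp
  \<comment> \<open>The first index at which \<open>w i\<close> has its variable. The new variables are indexed by the branch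
    nodes there; at later indices the branches lead back to them.\<close>
  define l0 where "l0 = (\<lambda>i. n i + pos i)"
  define \<tau> where "\<tau> = (\<lambda>i l s. case w i ! (l - n i) of
      Some b \<Rightarrow> Letter (b l s)
    | None \<Rightarrow> if s \<in> vbranch i l ` ?P i then Var (vbranch i (l0 i) (?inv i l s))
              else Letter z)"
  let ?E = "\<lambda>i. branch_nodes i (l0 i)"
  have le_l0: "i \<le> l0 i" for i using le_n[of i] by (simp add: l0_def)
  have adm: "admissible (\<tau> i) (?E i) (n i) (n (Suc i))" for i
    unfolding admissible_def
  proof (intro conjI exI[of _ "l0 i"] ballI allI impI)
    show "n i \<le> l0 i" "l0 i < n (Suc i)" using pos[of i] by (simp_all add: l0_def nS)
    show "length (?E i) = length Ts" by (simp add: branch_nodes_def)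
    show "?E i ! r \<noteq> {}" if r: "r < length Ts" for r
    proof -
      obtain j where "vector_level_subset Ts j (D i)" by (rule D_level)
      then show ?thesis using r by (simp add: branch_nodes_def vector_level_subset_def)
    qed
    show "?E i ! r \<subseteq> D (l0 i) ! r" if "r < length Ts" for r
      using that branch_in[OF that _ le_l0[of i]] by (auto simp: branch_nodes_def)
    show "\<tau> i (l0 i) u = Var u" if "u \<in> listset (?E i)" for u
      using that pos[of i] by (simp add: \<tau>_def l0_def listset_branch_nodes f_inv_into_f)
    fix l s assume l: "l \<in> {n i..<n (Suc i)}" and s: "s \<in> ?P l"
    then have p: "l - n i < length (w i)" by (auto simp: nS)
    have il: "i \<le> l" using le_n[of i] l by simp
    show "\<tau> i l s \<in> Letter ` \<Lambda> \<union> Var ` listset (?E i)"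
    proof (cases "w i ! (l - n i)")
      case None
      show ?thesis
      proof (cases "s \<in> vbranch i l ` ?P i")
        case True
        then have "?inv i l s \<in> ?P i" by (rule inv_into_into)
        then have "vbranch i (l0 i) (?inv i l s) \<in> listset (?E i)"
          unfolding listset_branch_nodes by (rule imageI)
        then show ?thesis using None True by (simp add: \<tau>_def)
      qed (use None z in \<open>simp add: \<tau>_def\<close>)
    next
      case (Some b)
      then have "Some b \<in> set (w i)" using nth_mem[OF p] by simp
      then have "b \<in> (\<Union>i. A i)" using w_letters[of i] by auto
      then have "b l s \<in> \<Lambda>" using A_val by blast
      then show ?thesis using Some by (simp add: \<tau>_def)
    qed
    fix u assume u: "\<tau> i l s = Var u"
    then have None: "w i ! (l - n i) = None" by (auto simp: \<tau>_def split: option.splits)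
    then have s': "s \<in> vbranch i l ` ?P i" and u': "u = vbranch i (l0 i) (?inv i l s)"
      using u by (auto simp: \<tau>_def split: if_splits)
    have "l0 i \<le> l" using pos_le[OF p None] l by (auto simp: l0_def)
    then have "(vbranch i (l0 i) (?inv i l s), vbranch i l (?inv i l s)) \<in> level_product_order Ts"
      using inv_into_into[OF s'] le_l0 by (intro vbranch_mono)
    then show "(u, s) \<in> level_product_order Ts" using s' u' by (simp add: f_inv_into_f)
    fix v assume "v \<in> listset (?E i)"
    then obtain x where x: "x \<in> ?P i" "v = vbranch i (l0 i) x" by (auto simp: listset_branch_nodes)
    then have "\<tau> i l (vbranch i l x) = Var v"
      using None vbranch_inj[OF il] by (simp add: \<tau>_def)
    then show "\<exists>s'\<in>?P l. \<tau> i l s' = Var v" using vbranch_in[OF x(1) il] by blast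
  qed
  let ?Y = "\<lambda>i. glue X (\<tau> i) (n i) (n (Suc i))"
  have Y: "word_sequence Ts \<Lambda> ?Y ?E (\<lambda>i. N (n i))"
    using n0 adm by (rule word_sequence_glue)
  interpret Y: word_sequence Ts \<Lambda> ?Y ?E "\<lambda>i. N (n i)" by (rule Y)
  have "vdominates Ts (?E i) (vlevel Ts i)" for i
    using vdominates_trans[OF branch_nodes_dominate[OF le_l0] dom] .
  then have "subspace \<Lambda> Ts ?Y" using Y subspace_iff by blast
  moreover have "subspace_le \<Lambda> Ts ?Y X" using n n0 adm by (rule subspace_le_glue)
  moreover have "c f = k" if "f \<in> seq_span \<Lambda> Ts ?Y" for f
  proof -
    from that obtain q where q: "q \<ge> 1" and "f \<in> finite_span \<Lambda> Ts ?Y q"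
      by (auto simp: seq_span_def)
    then obtain h where h: "\<forall>i<q. \<forall>u\<in>listset (?E i). h i u \<in> \<Lambda>" and f: "f = fill ?Y h q"
      unfolding Y.finite_span_iff by blast
    define a where "a = (\<lambda>i. letter i (\<lambda>x\<in>?P i. h i (vbranch i (l0 i) x)))"
    have a: "a i \<in> A i" if "i < q" for i
      unfolding a_def A_def using h that by (auto simp: listset_branch_nodes)
    define W where "W = concat (map (\<lambda>i. plug (a i) (w i)) [0..<q])"
    have W_nth: "W ! l = (case w i ! (l - n i) of None \<Rightarrow> a i | Some b \<Rightarrow> b)"
      if "i < q" "n i \<le> l" "l < n (Suc i)" for i l
    proof -
      have p: "l - n i < length (w i)" using that by (simp add: nS)
      then have "W ! (n i + (l - n i)) = plug (a i) (w i) ! (l - n i)"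
        using nth_concat_upt[OF that(1), of "l - n i" "\<lambda>i. plug (a i) (w i)"]
        by (simp add: W_def n_def)
      then show ?thesis using that(2) p by (simp add: plug_def)
    qed
    have "f = fill X (\<lambda>l s. (W ! l) l s) (n q)"
      unfolding f
    proof (rule fill_glue[OF n n0 adm])
      fix i l s assume i: "i < q" "n i \<le> l" "l < n (Suc i)"
      show "(W ! l) l s = (case \<tau> i l s of Letter x \<Rightarrow> x | Var u \<Rightarrow> h i u)"
        unfolding W_nth[OF i]
        by (auto simp: \<tau>_def a_def letter_def inv_into_into split: option.split)
    qed
    moreover have "length W = n q" unfolding W_def length_concat_upt by (simp add: n_def)
    ultimately have "f = \<Phi> W" by (simp add: \<Phi>_def)
    then show ?thesis using mono[OF q a] by (simp add: W_def)
  qed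
  ultimately show thesis using that unfolding monochromatic_def by blast
qed

theorem theorem7:
  fixes \<Lambda> :: "'l set" and Ts :: "'a rel list"
    and c :: "('l, 'a) cword \<Rightarrow> 'c" and X :: "nat \<Rightarrow> ('l, 'a) vword"
  assumes "finite \<Lambda>"
    and "vector_tree Ts" and "infinite_height Ts"
    and "finite (c ` const_words \<Lambda> Ts)"
    and "subspace \<Lambda> Ts X"
  shows "\<exists>X'. subspace \<Lambda> Ts X' \<and> subspace_le \<Lambda> Ts X' X \<and>
              monochromatic c (seq_span \<Lambda> Ts X')"
proof -
  interpret infinite_vector_tree Ts using assms(2,3) by unfold_locales
  obtain D N where X: "word_sequence Ts \<Lambda> X D N" and dom: "\<And>i. vdominates Ts (D i) (vlevel Ts i)"
    using assms(5) subspace_iff by blast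
  interpret word_sequence Ts \<Lambda> X D N by (rule X)
  show ?thesis
  proof (cases "\<Lambda> = {}")
    case True
    \<comment> \<open>Without letters nothing can be substituted, and all spans are empty.\<close>
    have "listset (D 0) \<noteq> {}" using D_level[of 0] listset_nonempty by metis
    then have "finite_span \<Lambda> Ts X q = {}" if "q \<ge> 1" for q
      unfolding set_eq_iff finite_span_iff using True that by fastforce
    then have "seq_span \<Lambda> Ts X = {}" by (auto simp: seq_span_def)
    then show ?thesis using assms(5) by (auto simp: subspace_le_def monochromatic_def)
  next
    case False
    then obtain z where z: "z \<in> \<Lambda>" by blast
    obtain Y E M where Y: "word_sequence Ts \<Lambda> Y E M" "subspace_le \<Lambda> Ts Y X"
      "\<And>i. vdominates Ts (E i) (vlevel Ts i)" "\<And>i. vdominates Ts (E (Suc i)) (E i)"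
      using dominating_subsequence[OF dom z] by blast
    interpret Y: branching_sequence Ts \<Lambda> Y E M
      using Y(1,4) by (simp add: branching_sequence_def branching_sequence_axioms_def)
    obtain X' where "subspace \<Lambda> Ts X'" "subspace_le \<Lambda> Ts X' Y" "monochromatic c (seq_span \<Lambda> Ts X')"
      using Y.monochromatic_subspace[OF Y(3) z assms(1,4)] by blast
    then show ?thesis using Y(2) by (auto simp: subspace_le_def)
  qed
qed

end
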